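(* Let $\mu=(1^{m_1}2^{m_2}\cdots)$ be a partition of $n$ (with $m_i$ parts equal to $i$), and let $C(\mu)=\sum_{\lambda}\chi^\lambda_\mu$, the sum over all partitions $\lambda$ of $n$ (i.e. the sum of the entries in the column indexed by $\mu$ of the character table of the symmetric group $\mathfrak{S}_n$). Then $C(\mu)=\prod_{i>0}c_{i,m_i}$, where $$c_{i,m_i}=\begin{cases}0 & \text{if } i \text{ is even and } m_i \text{ is odd},\\ (m_i-1)!!\cdot i^{m_i/2} & \text{if } i \text{ is even and } m_i \text{ is even},\\ \displaystyle\sum_{k=0}^{\lfloor m_i/2\rfloor}\binom{m_i}{m_i-2k}\,(2k-1)!!\; i^k & \text{if } i \text{ is odd}.\end{cases}$$
   Context: $\chi^\lambda$ is the irreducible (complex) character of $\mathfrak{S}_n$ indexed by the partition $\lambda$ of $n$, and $\chi^\lambda_\mu$ is its value on a permutation of cycle type $\mu$, i.e. having $m_i$ cycles of length $i$ for each $i$. Double factorials are $(2k-1)!!=1\cdot3\cdots(2k-1)$, with $(-1)!!=1$ (so $c_{i,0}=1$ for all $i$). By the (known) Murnaghan–Nakayama rule, $\chi^\lambda_\mu=\sum_P\varepsilon(P)$, the sum being over all ribbon tableaux $P$ of shape $\lambda$ and content $\mu$, that is, sequences of partitions $\emptyset=\lambda^0\subset\lambda^1\subset\cdots\subset\lambda^\ell=\lambda$ such that each $\lambda^{i}/\lambda^{i-1}$ is a connected skew shape of size $\mu_i$ without $2\times2$ square of cells (a ribbon), where $\varepsilon(P)$ is the product over the ribbons of $(-1)^{(\text{number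 of rows occupied})-1}$. *)

theory Defs
  imports Complex_Main
    "HOL-Library.Function_Algebras"
    "HOL-Library.Multiset"
    "HOL-Combinatorics.Permutations"
    "HOL-Combinatorics.Orbits"
begin

definition is_partition :: "nat \<Rightarrow> nat list \<Rightarrow> bool" where
  "is_partition n \<nu> \<longleftrightarrow> sorted_wrt (\<ge>) \<nu> \<and> 0 \<notin> set \<nu> \<and> sum_list \<nu> = n"

text \<open>The symmetric group on \<open>n\<close> points consists of the \<open>w :: nat \<Rightarrow> nat\<close> with
  \<open>w permutes {..<n}\<close>. Fixed points contribute cycles of length 1 to the cycle type, since
  \<open>orbit w x = {x}\<close> when \<open>w x = x\<close>.\<close>

definition cycle_type :: "nat \<Rightarrow> (nat \<Rightarrow> nat) \<Rightarrow> nat multiset" where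
  "cycle_type n w = image_mset card (mset_set (orbit w ` {..<n}))"

definition cscale :: "complex \<Rightarrow> ('a \<Rightarrow> complex) \<Rightarrow> 'a \<Rightarrow> complex" where
  "cscale c f = (\<lambda>x. c * f x)"

interpretation cfun: vector_space "cscale :: complex \<Rightarrow> ('a \<Rightarrow> complex) \<Rightarrow> _"
  by unfold_locales (auto simp: cscale_def fun_eq_iff algebra_simps)

text \<open>Trace of a linear map \<open>T\<close> on a finite-dimensional subspace \<open>V\<close> that \<open>T\<close> maps to itself,
  computed in an arbitrary basis of \<open>V\<close>.\<close>

definition trace_on :: "('a \<Rightarrow> complex) set \<Rightarrow> (('a \<Rightarrow> complex) \<Rightarrow> 'a \<Rightarrow> complex) \<Rightarrow> complex" where
  "trace_on V T =
     (let B = (SOME B. B \<subseteq> V \<and> cfun.independent B \<and> V \<subseteq> cfun.span B)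
      in \<Sum>b\<in>B. cfun.representation B (T b) b)"

text \<open>The complex group algebra of the symmetric group: functions vanishing off the group,
  where \<open>x\<close> stands for the formal sum of the \<open>x p\<close> times \<open>p\<close>; the product extends composition of
  permutations.\<close>

definition group_algebra :: "nat \<Rightarrow> ((nat \<Rightarrow> nat) \<Rightarrow> complex) set" where
  "group_algebra n = {x. \<forall>p. \<not> p permutes {..<n} \<longrightarrow> x p = 0}"

definition ga_mult ::
  "nat \<Rightarrow> ((nat \<Rightarrow> nat) \<Rightarrow> complex) \<Rightarrow> ((nat \<Rightarrow> nat) \<Rightarrow> complex) \<Rightarrow> (nat \<Rightarrow> nat) \<Rightarrow> complex" where
  "ga_mult n x y =
     (\<lambda>p. if p permutes {..<n} then \<Sum>q | q permutes {..<n}. x q * y (inv q \<circ> p) else 0)"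

definition ga_of :: "(nat \<Rightarrow> nat) \<Rightarrow> (nat \<Rightarrow> nat) \<Rightarrow> complex" where
  "ga_of w = (\<lambda>p. if p = w then 1 else 0)"

text \<open>Row and column of the entry \<open>k < n\<close> in the tableau of shape \<open>\<nu>\<close> filled with
  \<open>0, 1, \<dots>, n - 1\<close> row by row from left to right.\<close>

definition tab_row :: "nat list \<Rightarrow> nat \<Rightarrow> nat" where
  "tab_row \<nu> k = (LEAST r. k < sum_list (take (Suc r) \<nu>))"

definition tab_col :: "nat list \<Rightarrow> nat \<Rightarrow> nat" where
  "tab_col \<nu> k = k - sum_list (take (tab_row \<nu> k) \<nu>)"

definition row_group :: "nat \<Rightarrow> nat list \<Rightarrow> (nat \<Rightarrow> nat) set" where
  "row_group n \<nu> = {p. p permutes {..<n} \<and> (\<forall>k<n. tab_row \<nu> (p k) = tab_row \<nu> k)}"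

definition col_group :: "nat \<Rightarrow> nat list \<Rightarrow> (nat \<Rightarrow> nat) set" where
  "col_group n \<nu> = {p. p permutes {..<n} \<and> (\<forall>k<n. tab_col \<nu> (p k) = tab_col \<nu> k)}"

definition young_symmetrizer :: "nat \<Rightarrow> nat list \<Rightarrow> (nat \<Rightarrow> nat) \<Rightarrow> complex" where
  "young_symmetrizer n \<nu> =
     ga_mult n (\<lambda>p. if p \<in> row_group n \<nu> then 1 else 0)
               (\<lambda>p. if p \<in> col_group n \<nu> then of_int (sign p) else 0)"

text \<open>The irreducible representation indexed by \<open>\<nu>\<close>: the left ideal of the group algebra
  generated by the Young symmetrizer (isomorphic to the Specht module of \<open>\<nu>\<close>), with the group
  acting by left multiplication. In this indexing \<open>[n]\<close> gives the trivial representation.\<close>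

definition irrep :: "nat \<Rightarrow> nat list \<Rightarrow> ((nat \<Rightarrow> nat) \<Rightarrow> complex) set" where
  "irrep n \<nu> = {ga_mult n x (young_symmetrizer n \<nu>) | x. x \<in> group_algebra n}"

definition irr_char :: "nat \<Rightarrow> nat list \<Rightarrow> (nat \<Rightarrow> nat) \<Rightarrow> complex" where
  "irr_char n \<nu> w = trace_on (irrep n \<nu>) (ga_mult n (ga_of w))"

definition char_value :: "nat \<Rightarrow> nat list \<Rightarrow> nat list \<Rightarrow> complex" where
  "char_value n \<nu> \<mu> =
     irr_char n \<nu> (SOME w. w permutes {..<n} \<and> cycle_type n w = mset \<mu>)"

definition column_sum :: "nat \<Rightarrow> nat list \<Rightarrow> complex" where
  "column_sum n \<mu> = (\<Sum>\<nu> | is_partition n \<nu>. char_value n \<nu> \<mu>)"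

text \<open>\<open>odd_dfact k\<close> is the double factorial \<open>(2k - 1)!!\<close>, which is 1 for \<open>k = 0\<close>.\<close>

definition odd_dfact :: "nat \<Rightarrow> nat" where
  "odd_dfact k = (\<Prod>j=1..k. 2 * j - 1)"

definition c_factor :: "nat \<Rightarrow> nat \<Rightarrow> nat" where
  "c_factor i m =
     (if even i \<and> odd m then 0
      else if even i then odd_dfact (m div 2) * i ^ (m div 2)
      else \<Sum>k=0..m div 2. (m choose (m - 2 * k)) * odd_dfact k * i ^ k)"

end

theory Submission
  imports Defs
begin

text \<open>Both sides count the square roots of a permutation \<open>w\<close> of cycle type \<open>\<mu>\<close>.

  For the left side, let \<open>e = a b\<close> be the Young symmetrizer of \<open>\<nu>\<close>, where \<open>a\<close> is the sum of the row
  group and \<open>b\<close> the signed sum of the column group. The element \<open>f = a b a\<close> is invariant under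
  inversion of group elements and each \<open>f g f\<close> is a multiple of \<open>f\<close>, which amounts to a functional
  equation for the coefficients of \<open>f\<close>. As \<open>\<chi>\<^sup>\<nu>\<close> is, up to a scalar, the conjugation average of \<open>f\<close>,
  this equation yields both \<open>\<Sum>\<^sub>w \<chi>\<^sup>\<nu>(w)\<^sup>2 = n!\<close> and the Frobenius--Schur identity
  \<open>\<Sum>\<^sub>v \<chi>\<^sup>\<nu>(v\<^sup>2) = n!\<close>. Dominance of partitions makes distinct \<open>\<chi>\<^sup>\<nu>\<close> orthogonal, and there
  are as many of them as cycle types, so expanding the class function that counts square roots in
  the \<open>\<chi>\<^sup>\<nu>\<close> gives all coefficients 1.

  For the right side, a square root of \<open>w\<close> permutes the cycles of \<open>w\<close>: it either fixes the cycle of a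
  given point, which has then odd length \<open>i\<close> and admits one square root, or swaps it with one of
  the \<open>m\<^sub>i - 1\<close> other cycles of length \<open>i\<close>, in \<open>i\<close> ways. This is the recursion of \<open>c\<^bsub>i,m\<^esub>\<close>.\<close>

section \<open>The group algebra of the symmetric group\<close>

definition sym_grp :: "nat \<Rightarrow> (nat \<Rightarrow> nat) set" where
  "sym_grp n = {p. p permutes {..<n}}"

lemma finite_sym_grp [simp]: "finite (sym_grp n)"
  by (simp add: sym_grp_def finite_permutations)

lemma card_sym_grp: "card (sym_grp n) = fact n"
  by (simp add: sym_grp_def card_permutations)

lemma sym_grp_id [simp]: "id \<in> sym_grp n"
  by (simp add: sym_grp_def permutes_id)

lemma sym_grp_comp [simp]: "p \<in> sym_grp n \<Longrightarrow> q \<in> sym_grp n \<Longrightarrow> p \<circ> q \<in> sym_grp n"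
  by (simp add: sym_grp_def permutes_compose)

lemma sym_grp_inv [simp]: "p \<in> sym_grp n \<Longrightarrow> inv p \<in> sym_grp n"
  by (simp add: sym_grp_def permutes_inv)

lemma sym_grp_inv_o [simp]:
  assumes "p \<in> sym_grp n"
  shows "inv p \<circ> p = id" "p \<circ> inv p = id"
    "inv p \<circ> (p \<circ> x) = x" "p \<circ> (inv p \<circ> x) = x" "inv (inv p) = p"
proof -
  have p: "p permutes {..<n}" using assms by (simp add: sym_grp_def)
  show 1: "inv p \<circ> p = id" "p \<circ> inv p = id" using permutes_inv_o[OF p] by auto
  show "inv p \<circ> (p \<circ> x) = x" "p \<circ> (inv p \<circ> x) = x" by (simp_all add: 1 flip: comp_assoc)
  show "inv (inv p) = p" by (rule permutes_inv_inv[OF p])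
qed

lemma sym_grp_inv_comp [simp]:
  assumes "p \<in> sym_grp n" "q \<in> sym_grp n"
  shows "inv (p \<circ> q) = inv q \<circ> inv p"
  using assms permutes_bij unfolding sym_grp_def by (blast intro: o_inv_distrib)

lemma sym_grp_less [simp]: "p \<in> sym_grp n \<Longrightarrow> p i < n \<longleftrightarrow> i < n"
  using permutes_in_image[of p "{..<n}" i] by (simp add: sym_grp_def)

lemma sym_grp_apply [simp]:
  assumes "p \<in> sym_grp n"
  shows "inv p (p i) = i" "p (inv p i) = i"
  using permutes_inverses[of p "{..<n}"] assms by (simp_all add: sym_grp_def)

lemma sym_grp_sign_comp:
  "p \<in> sym_grp n \<Longrightarrow> q \<in> sym_grp n \<Longrightarrow> sign (p \<circ> q) = sign p * sign q"
  by (intro sign_compose permutation_permutes[THEN iffD2] exI[of _ "{..<n}"])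
     (auto simp: sym_grp_def)

lemma sym_grp_sign_inv: "p \<in> sym_grp n \<Longrightarrow> sign (inv p) = sign p"
  by (intro sign_inverse permutation_permutes[THEN iffD2] exI[of _ "{..<n}"])
     (auto simp: sym_grp_def)

lemma sum_sym_grp_left:
  assumes "h \<in> sym_grp n"
  shows "(\<Sum>g\<in>sym_grp n. F (h \<circ> g)) = (\<Sum>g\<in>sym_grp n. F g)"
  by (rule sum.reindex_bij_witness[of _ "\<lambda>g. inv h \<circ> g" "\<lambda>g. h \<circ> g"]) (use assms in auto)

lemma sum_sym_grp_right:
  assumes "h \<in> sym_grp n"
  shows "(\<Sum>g\<in>sym_grp n. F (g \<circ> h)) = (\<Sum>g\<in>sym_grp n. F g)"
  by (rule sum.reindex_bij_witness[of _ "\<lambda>g. g \<circ> inv h" "\<lambda>g. g \<circ> h"])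
     (use assms in \<open>auto simp: comp_assoc\<close>)

lemma sum_sym_grp_inv: "(\<Sum>g\<in>sym_grp n. F (inv g)) = (\<Sum>g\<in>sym_grp n. F g)"
  by (rule sum.reindex_bij_witness[of _ inv inv]) auto

lemma sum_sym_grp_conj:
  assumes "h \<in> sym_grp n"
  shows "(\<Sum>g\<in>sym_grp n. F (inv h \<circ> g \<circ> h)) = (\<Sum>g\<in>sym_grp n. F g)"
  using sum_sym_grp_right[OF assms, of "\<lambda>g. F (inv h \<circ> g)"]
    sum_sym_grp_left[OF sym_grp_inv[OF assms], of F]
  by (simp add: comp_assoc)

section \<open>Convolution in the group algebra\<close>

lemma ga_mult_eq:
  "ga_mult n x y p = (if p \<in> sym_grp n then \<Sum>q\<in>sym_grp n. x q * y (inv q \<circ> p) else 0)"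
  by (simp add: ga_mult_def sym_grp_def)

lemma ga_mult_eq_right:
  assumes "p \<in> sym_grp n"
  shows "ga_mult n x y p = (\<Sum>q\<in>sym_grp n. x (p \<circ> inv q) * y q)"
proof -
  have "ga_mult n x y p = (\<Sum>q\<in>sym_grp n. x q * y (inv q \<circ> p))"
    using assms by (simp add: ga_mult_eq)
  also have "\<dots> = (\<Sum>q\<in>sym_grp n. x (inv q) * y (q \<circ> p))"
    using sum_sym_grp_inv[of "\<lambda>q. x q * y (inv q \<circ> p)" n] by (simp cong: sum.cong)
  also have "\<dots> = (\<Sum>q\<in>sym_grp n. x (p \<circ> inv q) * y q)"
    using sum_sym_grp_right[OF assms, of "\<lambda>q. x (p \<circ> inv q) * y q"] assms
    by (simp cong: sum.cong)
  finally show ?thesis .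
qed

lemma ga_mult_assoc: "ga_mult n (ga_mult n x y) z = ga_mult n x (ga_mult n y z)"
proof
  fix p
  show "ga_mult n (ga_mult n x y) z p = ga_mult n x (ga_mult n y z) p"
  proof (cases "p \<in> sym_grp n")
    case True
    have "ga_mult n (ga_mult n x y) z p
        = (\<Sum>q\<in>sym_grp n. \<Sum>r\<in>sym_grp n. x r * y (inv r \<circ> q) * z (inv q \<circ> p))"
      using True by (simp add: ga_mult_eq sum_distrib_right cong: sum.cong)
    also have "\<dots> = (\<Sum>r\<in>sym_grp n. \<Sum>q\<in>sym_grp n. x r * y (inv r \<circ> q) * z (inv q \<circ> p))"
      by (rule sum.swap)
    also have "\<dots> = (\<Sum>r\<in>sym_grp n. \<Sum>q\<in>sym_grp n. x r * y q * z (inv q \<circ> (inv r \<circ> p)))"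
    proof (rule sum.cong[OF refl])
      fix r assume r: "r \<in> sym_grp n"
      show "(\<Sum>q\<in>sym_grp n. x r * y (inv r \<circ> q) * z (inv q \<circ> p))
          = (\<Sum>q\<in>sym_grp n. x r * y q * z (inv q \<circ> (inv r \<circ> p)))"
        using sum_sym_grp_left[OF r, of "\<lambda>q. x r * y (inv r \<circ> q) * z (inv q \<circ> p)"] r
        by (simp add: comp_assoc cong: sum.cong)
    qed
    also have "\<dots> = ga_mult n x (ga_mult n y z) p"
      using True by (simp add: ga_mult_eq sum_distrib_left mult.assoc cong: sum.cong)
    finally show ?thesis .
  qed (simp add: ga_mult_eq)
qed

lemma group_algebra_iff: "x \<in> group_algebra n \<longleftrightarrow> (\<forall>p. p \<notin> sym_grp n \<longrightarrow> x p = 0)"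
  by (simp add: group_algebra_def sym_grp_def)

lemma ga_mult_in_group_algebra [simp]: "ga_mult n x y \<in> group_algebra n"
  by (simp add: group_algebra_iff ga_mult_eq)

lemma ga_of_in_group_algebra [simp]: "w \<in> sym_grp n \<Longrightarrow> ga_of w \<in> group_algebra n"
  by (auto simp: group_algebra_iff ga_of_def)

lemma group_algebra_eqI:
  assumes "x \<in> group_algebra n" "y \<in> group_algebra n" "\<And>p. p \<in> sym_grp n \<Longrightarrow> x p = y p"
  shows "x = y"
  using assms unfolding group_algebra_iff fun_eq_iff by metis

lemma ga_mult_ga_of:
  assumes "w \<in> sym_grp n" "p \<in> sym_grp n"
  shows "ga_mult n (ga_of w) y p = y (inv w \<circ> p)"
  using assms by (simp add: ga_mult_eq ga_of_def if_distrib[of "\<lambda>t. t * _"] cong: if_cong)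

lemma ga_mult_one:
  assumes "y \<in> group_algebra n"
  shows "ga_mult n (ga_of id) y = y" "ga_mult n y (ga_of id) = y"
proof -
  show "ga_mult n (ga_of id) y = y"
    by (rule group_algebra_eqI[OF _ assms]) (auto simp: ga_mult_ga_of)
  show "ga_mult n y (ga_of id) = y"
    by (rule group_algebra_eqI[OF _ assms])
       (auto simp: ga_mult_eq_right ga_of_def if_distrib[of "\<lambda>t. _ * t"] cong: if_cong)
qed

lemma ga_mult_linear:
  "ga_mult n (x + x') y = ga_mult n x y + ga_mult n x' y"
  "ga_mult n x (y + y') = ga_mult n x y + ga_mult n x y'"
  "ga_mult n (cscale k x) y = cscale k (ga_mult n x y)"
  "ga_mult n x (cscale k y) = cscale k (ga_mult n x y)"
  by (auto simp: fun_eq_iff ga_mult_eq cscale_def algebra_simps sum.distrib sum_distrib_left)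

lemma ga_mult_zero [simp]: "ga_mult n 0 y = 0" "ga_mult n x 0 = 0"
  by (auto simp: fun_eq_iff ga_mult_eq)

lemma ga_mult_sum_left: "ga_mult n (\<Sum>i\<in>I. f i) y = (\<Sum>i\<in>I. ga_mult n (f i) y)"
  by (induction I rule: infinite_finite_induct)
     (simp_all only: sum.infinite sum.empty sum.insert ga_mult_linear
       ga_mult_zero not_False_eq_True)

lemma ga_mult_sum_right: "ga_mult n x (\<Sum>i\<in>I. f i) = (\<Sum>i\<in>I. ga_mult n x (f i))"
  by (induction I rule: infinite_finite_induct)
     (simp_all only: sum.infinite sum.empty sum.insert ga_mult_linear
       ga_mult_zero not_False_eq_True)

lemma fun_sum_apply: "(\<Sum>i\<in>I. f i) p = (\<Sum>i\<in>I. f i p)"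
  by (induction I rule: infinite_finite_induct) auto

lemma ga_expand:
  assumes "x \<in> group_algebra n"
  shows "x = (\<Sum>g\<in>sym_grp n. cscale (x g) (ga_of g))"
proof
  fix p
  show "x p = (\<Sum>g\<in>sym_grp n. cscale (x g) (ga_of g)) p"
    using assms
    by (auto simp: fun_sum_apply cscale_def ga_of_def group_algebra_iff if_distrib[of "\<lambda>t. _ * t"] cong: if_cong)
qed

text \<open>On the image of an idempotent, the trace is the trace of the composite with the projection,
  which can be read off in the basis of group elements.\<close>

lemma trace_on_left_ideal:
  assumes ee: "ga_mult n e e = cscale c e" and c: "c \<noteq> 0" and w: "w \<in> sym_grp n"
  defines "V \<equiv> {ga_mult n x e | x. x \<in> group_algebra n}"
  shows "trace_on V (ga_mult n (ga_of w))
    = (\<Sum>g\<in>sym_grp n. e (inv g \<circ> inv w \<circ> g)) / c"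
proof -
  let ?T = "ga_mult n (ga_of w)"
  \<comment> \<open>As \<open>e\<close> is idempotent up to the factor \<open>c\<close>, right
    multiplication by \<open>e\<close>, divided by \<open>c\<close>, projects the group algebra onto
    \<open>V\<close>.\<close>
  define P where "P = (\<lambda>x. cscale (1 / c) (ga_mult n x e))"
  have scale: "cscale 1 x = x" "cscale a (cscale b x) = cscale (a * b) x" for a b x
    by (auto simp: cscale_def fun_eq_iff)
  have PV: "P x \<in> V" if "x \<in> group_algebra n" for x
  proof -
    have "P x = ga_mult n (cscale (1 / c) x) e" by (simp add: P_def ga_mult_linear)
    moreover have "cscale (1 / c) x \<in> group_algebra n"
      using that by (auto simp: group_algebra_iff cscale_def)
    ultimately show ?thesis by (auto simp: V_def)
  qed
  have VA: "V \<subseteq> group_algebra n" by (auto simp: V_def)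
  have Pid: "P v = v" if "v \<in> V" for v
  proof -
    from that obtain x where v: "v = ga_mult n x e" by (auto simp: V_def)
    show ?thesis using c by (simp add: P_def v ga_mult_assoc ee ga_mult_linear scale)
  qed
  have TV: "?T v \<in> V" if "v \<in> V" for v
  proof -
    from that obtain x where v: "v = ga_mult n x e" by (auto simp: V_def)
    have "?T v = ga_mult n (ga_mult n (ga_of w) x) e" by (simp add: v ga_mult_assoc)
    then show ?thesis by (auto simp: V_def)
  qed
  \<comment> \<open>The same choice as in \<open>trace_on\<close>, so that the trace unfolds to a
    sum over this \<open>B\<close>.\<close>
  define B where "B = (SOME B. B \<subseteq> V \<and> cfun.independent B \<and> V \<subseteq> cfun.span B)"
  have B: "B \<subseteq> V \<and> cfun.independent B \<and> V \<subseteq> cfun.span B"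
    unfolding B_def by (rule someI_ex) (metis cfun.maximal_independent_subset[of V])
  have "group_algebra n \<subseteq> cfun.span (ga_of ` sym_grp n)"
  proof
    fix x assume "x \<in> group_algebra n"
    then have "x = (\<Sum>g\<in>sym_grp n. cscale (x g) (ga_of g))" by (rule ga_expand)
    also have "\<dots> \<in> cfun.span (ga_of ` sym_grp n)"
      by (intro cfun.span_sum cfun.span_scale cfun.span_base) auto
    finally show "x \<in> cfun.span (ga_of ` sym_grp n)" .
  qed
  then have "B \<subseteq> cfun.span (ga_of ` sym_grp n)" using B VA by blast
  then have finB: "finite B" using cfun.independent_span_bound[of "ga_of ` sym_grp n" B] B by simp
  let ?r = "cfun.representation B"
  have ind: "cfun.independent B" using B by simp
  have spanV: "v \<in> cfun.span B" if "v \<in> V" for v using B that by blast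
  have expand: "(\<Sum>b\<in>B. cscale (?r v b) b) = v" if "v \<in> V" for v
    by (rule cfun.sum_representation_eq[OF ind]) (use that spanV finB in auto)
  \<comment> \<open>Expanding \<open>b'\<close> in group elements and projecting turns its
    \<open>b\<close>-coordinate into this sum.\<close>
  have dual: "(\<Sum>g\<in>sym_grp n. b' g * ?r (P (ga_of g)) b) = (if b = b' then 1 else 0)"
    if "b \<in> B" "b' \<in> B" for b b'
  proof -
    have b': "b' \<in> V" using B that by auto
    have "b' = P b'" using Pid[OF b'] by simp
    also have "\<dots> = P (\<Sum>g\<in>sym_grp n. cscale (b' g) (ga_of g))"
      using ga_expand[of b' n] VA b' by auto
    also have "\<dots> = (\<Sum>g\<in>sym_grp n. cscale (b' g) (P (ga_of g)))"
      by (simp add: P_def ga_mult_sum_left ga_mult_linear cfun.scale_sum_right mult.commute)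
    finally have b'_eq: "b' = (\<Sum>g\<in>sym_grp n. cscale (b' g) (P (ga_of g)))" .
    have "?r b' b = ?r (\<Sum>g\<in>sym_grp n. cscale (b' g) (P (ga_of g))) b"
      using b'_eq by simp
    also have "\<dots> = (\<Sum>g\<in>sym_grp n. ?r (cscale (b' g) (P (ga_of g))) b)"
      by (subst cfun.representation_sum[OF ind]) (simp_all add: cfun.span_scale spanV PV)
    also have "\<dots> = (\<Sum>g\<in>sym_grp n. b' g * ?r (P (ga_of g)) b)"
      by (intro sum.cong refl, subst cfun.representation_scale[OF ind]) (simp_all add: spanV PV)
    finally show ?thesis using cfun.representation_basis[OF ind that(2)] by auto
  qed
  \<comment> \<open>The trace of \<open>?T\<close> after \<open>P\<close> in the basis of group
    elements. Rewritten in coordinates of \<open>B\<close>, it becomes the trace of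
    \<open>?T\<close> on \<open>V\<close> by \<open>dual\<close>.\<close>
  have "(\<Sum>g\<in>sym_grp n. ?T (P (ga_of g)) g)
      = (\<Sum>g\<in>sym_grp n. \<Sum>b\<in>B. \<Sum>b'\<in>B. ?r (P (ga_of g)) b * (?r (?T b) b' * b' g))"
  proof (rule sum.cong[OF refl])
    fix g assume g: "g \<in> sym_grp n"
    have "?T (P (ga_of g)) = ?T (\<Sum>b\<in>B. cscale (?r (P (ga_of g)) b) b)"
      by (subst expand) (use g PV in auto)
    also have "\<dots> = (\<Sum>b\<in>B. cscale (?r (P (ga_of g)) b) (?T b))"
      by (simp add: ga_mult_sum_right ga_mult_linear)
    also have "\<dots> = (\<Sum>b\<in>B. cscale (?r (P (ga_of g)) b) (\<Sum>b'\<in>B. cscale (?r (?T b) b') b'))"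
      by (intro sum.cong refl, subst expand) (use B TV in auto)
    finally show "?T (P (ga_of g)) g
        = (\<Sum>b\<in>B. \<Sum>b'\<in>B. ?r (P (ga_of g)) b * (?r (?T b) b' * b' g))"
      by (simp add: fun_sum_apply cscale_def sum_distrib_left)
  qed
  also have "\<dots> = (\<Sum>b\<in>B. \<Sum>b'\<in>B. \<Sum>g\<in>sym_grp n. ?r (P (ga_of g)) b * (?r (?T b) b' * b' g))"
    by (subst sum.swap, subst sum.swap) (rule refl)
  also have "\<dots> = (\<Sum>b\<in>B. \<Sum>b'\<in>B. ?r (?T b) b' * (\<Sum>g\<in>sym_grp n. b' g * ?r (P (ga_of g)) b))"
    by (simp add: sum_distrib_left mult_ac)
  also have "\<dots> = (\<Sum>b\<in>B. \<Sum>b'\<in>B. ?r (?T b) b' * (if b = b' then 1 else 0))"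
    by (intro sum.cong refl) (simp add: dual)
  also have "\<dots> = (\<Sum>b\<in>B. ?r (?T b) b)"
    using finB by (simp add: if_distrib[of "\<lambda>t. _ * t"] cong: if_cong)
  also have "\<dots> = trace_on V ?T"
    by (simp add: trace_on_def Let_def B_def)
  finally have "trace_on V ?T = (\<Sum>g\<in>sym_grp n. ?T (P (ga_of g)) g)" by simp
  also have "\<dots> = (\<Sum>g\<in>sym_grp n. e (inv g \<circ> inv w \<circ> g) / c)"
  proof (rule sum.cong[OF refl])
    fix g assume g: "g \<in> sym_grp n"
    have "?T (P (ga_of g)) g = P (ga_of g) (inv w \<circ> g)" using g w by (simp add: ga_mult_ga_of)
    also have "\<dots> = e (inv g \<circ> (inv w \<circ> g)) / c"
      using g w by (simp add: P_def cscale_def ga_mult_ga_of)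
    finally show "?T (P (ga_of g)) g = e (inv g \<circ> inv w \<circ> g) / c" by (simp add: comp_assoc)
  qed
  finally show ?thesis by (simp add: sum_divide_distrib)
qed

section \<open>Tableaux and Young symmetrizers\<close>

lemma sum_list_take_mono: "r \<le> s \<Longrightarrow> sum_list (take r \<nu>) \<le> sum_list (take s (\<nu> :: nat list))"
  by (metis le_add1 le_add_diff_inverse sum_list_append take_add)

lemma sum_list_take_le: "sum_list (take r \<nu>) \<le> sum_list (\<nu> :: nat list)"
  by (metis append_take_drop_id le_add1 sum_list_append)

lemma sum_list_take_Suc:
  "sum_list (take (Suc r) \<nu>) = sum_list (take r \<nu>) + (if r < length \<nu> then \<nu> ! r else 0 :: nat)"
  by (simp add: take_Suc_conv_app_nth)

text \<open>Provides, for distinct partitions, a partial sum in which they differ. Parts 0 are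
  excluded because partial sums do not see trailing zeros.\<close>

lemma sum_list_take_inject:
  fixes \<nu> \<nu>' :: "nat list"
  assumes "\<And>r. sum_list (take r \<nu>) = sum_list (take r \<nu>')" "0 \<notin> set \<nu>" "0 \<notin> set \<nu>'"
  shows "\<nu> = \<nu>'"
  using assms
proof (induction \<nu> arbitrary: \<nu>')
  case Nil
  then show ?case using Nil.prems(1)[of 1] by (cases \<nu>') auto
next
  case (Cons a \<nu>)
  show ?case
  proof (cases \<nu>')
    case Nil
    then show ?thesis using Cons.prems(1)[of 1] Cons.prems(2) by auto
  next
    case (Cons b \<nu>'')
    have ab: "a = b" using Cons.prems(1)[of 1] Cons by simp
    have "sum_list (take r \<nu>) = sum_list (take r \<nu>'')" for r
      using Cons.prems(1)[of "Suc r"] Cons ab by simp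
    then show ?thesis using Cons.IH[of \<nu>''] Cons.prems Cons ab by auto
  qed
qed

lemma tab_row_bounds:
  assumes "k < sum_list \<nu>"
  shows "sum_list (take (tab_row \<nu> k) \<nu>) \<le> k" "k < sum_list (take (Suc (tab_row \<nu> k)) \<nu>)"
proof -
  have "k < sum_list (take (Suc (length \<nu>)) \<nu>)" using assms by simp
  then show "k < sum_list (take (Suc (tab_row \<nu> k)) \<nu>)" unfolding tab_row_def by (rule LeastI)
  show "sum_list (take (tab_row \<nu> k) \<nu>) \<le> k"
  proof (cases "tab_row \<nu> k")
    case (Suc r)
    then have "\<not> k < sum_list (take (Suc r) \<nu>)" unfolding tab_row_def by (intro not_less_Least) simp
    then show ?thesis using Suc by simp
  qed simp
qed

lemma tab_row_less_iff:
  assumes "k < sum_list \<nu>"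
  shows "tab_row \<nu> k < r \<longleftrightarrow> k < sum_list (take r \<nu>)"
  using tab_row_bounds[OF assms] sum_list_take_mono[of "Suc (tab_row \<nu> k)" r \<nu>]
    sum_list_take_mono[of r "tab_row \<nu> k" \<nu>]
  by (metis Suc_leI leD leI order.strict_trans2)

lemma tab_row_eqI:
  assumes "sum_list (take r \<nu>) \<le> k" "k < sum_list (take (Suc r) \<nu>)"
  shows "tab_row \<nu> k = r"
proof -
  have "k < sum_list \<nu>" using assms(2) sum_list_take_le[of "Suc r" \<nu>] by simp
  then show ?thesis using tab_row_less_iff[of k \<nu> r] tab_row_less_iff[of k \<nu> "Suc r"] assms by simp
qed

lemma inj_on_tab_row_col: "inj_on (\<lambda>k. (tab_row \<nu> k, tab_col \<nu> k)) {..<sum_list \<nu>}"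
  by (intro inj_onI) (auto simp: tab_col_def dest!: tab_row_bounds(1))

text \<open>Rows do not get longer going down, so every row above that of \<open>k\<close> reaches
  at least to the column of \<open>k\<close>.\<close>

lemma tab_column_downward:
  assumes "sorted_wrt (\<ge>) \<nu>" "k < sum_list \<nu>" "r \<le> tab_row \<nu> k"
  shows "\<exists>k'<sum_list \<nu>. tab_row \<nu> k' = r \<and> tab_col \<nu> k' = tab_col \<nu> k"
proof -
  let ?R = "tab_row \<nu> k"
  note b = tab_row_bounds[OF assms(2)]
  have R: "?R < length \<nu>" and "tab_col \<nu> k < \<nu> ! ?R"
    using b by (auto simp: sum_list_take_Suc tab_col_def split: if_splits)
  moreover have "\<nu> ! ?R \<le> \<nu> ! r"
    using assms(1,3) R sorted_wrt_nth_less[OF assms(1), of r ?R] by (cases "r = ?R") auto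
  ultimately have c: "tab_col \<nu> k < \<nu> ! r" and r: "r < length \<nu>" using assms(3) by auto
  let ?k = "sum_list (take r \<nu>) + tab_col \<nu> k"
  have lt: "?k < sum_list (take (Suc r) \<nu>)" using c r by (simp add: sum_list_take_Suc)
  then have row: "tab_row \<nu> ?k = r" by (intro tab_row_eqI) auto
  moreover have "tab_col \<nu> ?k = tab_col \<nu> k" unfolding tab_col_def[of \<nu> ?k] row by simp
  ultimately show ?thesis using lt sum_list_take_le[of "Suc r" \<nu>]
    by (intro exI[of _ ?k]) auto
qed

section \<open>Cells in the first rows and dominance\<close>

lemma card_tab_row_less: "card {k \<in> {..<sum_list \<nu>}. tab_row \<nu> k < r} = sum_list (take r \<nu>)"
proof -
  have "{k \<in> {..<sum_list \<nu>}. tab_row \<nu> k < r} = {..<sum_list (take r \<nu>)}"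
    using sum_list_take_le[of r \<nu>] by (auto simp: tab_row_less_iff)
  then show ?thesis by simp
qed

text \<open>The columns of \<open>J\<close> are initial segments, so among all arrangements with the same column
  sizes \<open>J\<close> has the largest possible number of cells in the first \<open>r\<close> rows.\<close>

lemma card_rows_column_le:
  fixes \<rho> :: "'a \<Rightarrow> nat" and \<rho>' :: "'b \<Rightarrow> nat"
  assumes fin: "finite I" "finite J"
    and inj: "inj_on (\<lambda>i. (\<rho> i, \<gamma> i)) I"
    and down: "\<And>j r. j \<in> J \<Longrightarrow> r \<le> \<rho>' j \<Longrightarrow> \<exists>j'\<in>J. \<rho>' j' = r \<and> \<gamma>' j' = \<gamma>' j"
    and cols: "card {i\<in>I. \<gamma> i = c} = card {j\<in>J. \<gamma>' j = c}"
  shows "card {i\<in>I. \<rho> i < r \<and> \<gamma> i = c} \<le> card {j\<in>J. \<rho>' j < r \<and> \<gamma>' j = c}"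
proof (cases "\<exists>j\<in>J. \<gamma>' j = c \<and> r \<le> \<rho>' j")
  case True
  then obtain j where j: "j \<in> J" "\<gamma>' j = c" "r \<le> \<rho>' j" by blast
  have "{..<r} \<subseteq> \<rho>' ` {j\<in>J. \<rho>' j < r \<and> \<gamma>' j = c}"
  proof
    fix s assume s: "s \<in> {..<r}"
    then obtain j' where "j' \<in> J" "\<rho>' j' = s" "\<gamma>' j' = \<gamma>' j"
      using down[OF j(1), of s] j(3) by auto
    then show "s \<in> \<rho>' ` {j\<in>J. \<rho>' j < r \<and> \<gamma>' j = c}" using s j(2) by auto
  qed
  then have "r \<le> card {j\<in>J. \<rho>' j < r \<and> \<gamma>' j = c}"
    using surj_card_le[of "{j\<in>J. \<rho>' j < r \<and> \<gamma>' j = c}" "{..<r}" \<rho>'] fin by simp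
  moreover have "card {i\<in>I. \<rho> i < r \<and> \<gamma> i = c} \<le> card {..<r}"
    by (rule card_inj_on_le[of \<rho>]) (use inj in \<open>auto simp: inj_on_def\<close>)
  ultimately show ?thesis by simp
next
  case False
  then have "{j\<in>J. \<rho>' j < r \<and> \<gamma>' j = c} = {j\<in>J. \<gamma>' j = c}" by (auto simp: not_le)
  moreover have "card {i\<in>I. \<rho> i < r \<and> \<gamma> i = c} \<le> card {i\<in>I. \<gamma> i = c}"
    using fin by (intro card_mono) auto
  ultimately show ?thesis using cols by simp
qed

lemma card_rows_by_columns:
  assumes "finite I" "finite C" "\<gamma> ` I \<subseteq> C"
  shows "card {i\<in>I. \<rho> i < (r::nat)} = (\<Sum>c\<in>C. card {i\<in>I. \<rho> i < r \<and> \<gamma> i = c})"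
proof -
  have "{i\<in>I. \<rho> i < r} = (\<Union>c\<in>C. {i\<in>I. \<rho> i < r \<and> \<gamma> i = c})" using assms(3) by auto
  also have "card \<dots> = (\<Sum>c\<in>C. card {i\<in>I. \<rho> i < r \<and> \<gamma> i = c})"
    by (rule card_UN_disjoint) (use assms in auto)
  finally show ?thesis .
qed

text \<open>Summed over all columns, the columnwise bound says that a filling with at most one entry
  for each row and column is dominated by the shape \<open>J\<close>.\<close>

lemma card_rows_le:
  fixes \<rho> :: "'a \<Rightarrow> nat" and \<rho>' :: "'b \<Rightarrow> nat"
  assumes fin: "finite I" "finite J"
    and inj: "inj_on (\<lambda>i. (\<rho> i, \<gamma> i)) I"
    and down: "\<And>j r. j \<in> J \<Longrightarrow> r \<le> \<rho>' j \<Longrightarrow> \<exists>j'\<in>J. \<rho>' j' = r \<and> \<gamma>' j' = \<gamma>' j"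
    and cols: "\<And>c. card {i\<in>I. \<gamma> i = c} = card {j\<in>J. \<gamma>' j = c}"
  shows "card {i\<in>I. \<rho> i < r} \<le> card {j\<in>J. \<rho>' j < r}"
proof -
  let ?C = "\<gamma> ` I \<union> \<gamma>' ` J"
  have "card {i\<in>I. \<rho> i < r} = (\<Sum>c\<in>?C. card {i\<in>I. \<rho> i < r \<and> \<gamma> i = c})"
    by (rule card_rows_by_columns) (use fin in auto)
  also have "\<dots> \<le> (\<Sum>c\<in>?C. card {j\<in>J. \<rho>' j < r \<and> \<gamma>' j = c})"
    by (intro sum_mono card_rows_column_le[OF fin inj down cols])
  also have "\<dots> = card {j\<in>J. \<rho>' j < r}"
    by (rule card_rows_by_columns[symmetric]) (use fin in auto)
  finally show ?thesis .
qed

text \<open>When the totals agree, all columnwise bounds are equalities. Comparing them for the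
  first \<open>\<rho> i\<close> and the first \<open>Suc (\<rho> i)\<close> rows exhibits a cell of
  \<open>J\<close> in exactly the required row.\<close>

lemma rows_columns_cell:
  fixes \<rho> :: "'a \<Rightarrow> nat" and \<rho>' :: "'b \<Rightarrow> nat"
  assumes fin: "finite I" "finite J"
    and inj: "inj_on (\<lambda>i. (\<rho> i, \<gamma> i)) I"
    and down: "\<And>j r. j \<in> J \<Longrightarrow> r \<le> \<rho>' j \<Longrightarrow> \<exists>j'\<in>J. \<rho>' j' = r \<and> \<gamma>' j' = \<gamma>' j"
    and cols: "\<And>c. card {i\<in>I. \<gamma> i = c} = card {j\<in>J. \<gamma>' j = c}"
    and rows: "\<And>r. card {i\<in>I. \<rho> i < r} = card {j\<in>J. \<rho>' j < r}"
    and i: "i \<in> I"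
  shows "\<exists>j\<in>J. \<rho>' j = \<rho> i \<and> \<gamma>' j = \<gamma> i"
proof -
  let ?C = "\<gamma> ` I \<union> \<gamma>' ` J"
  define A where "A = (\<lambda>r. {i'\<in>I. \<rho> i' < r \<and> \<gamma> i' = \<gamma> i})"
  define A' where "A' = (\<lambda>r. {j\<in>J. \<rho>' j < r \<and> \<gamma>' j = \<gamma> i})"
  have eq: "card (A r) = card (A' r)" for r
  proof -
    have "(\<Sum>c\<in>?C. card {i\<in>I. \<rho> i < r \<and> \<gamma> i = c}) = (\<Sum>c\<in>?C. card {j\<in>J. \<rho>' j < r \<and> \<gamma>' j = c})"
      using rows[of r] card_rows_by_columns[of I ?C \<gamma> \<rho> r] card_rows_by_columns[of J ?C \<gamma>' \<rho>' r] fin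
      by simp
    from sum_mono_inv[OF this card_rows_column_le[OF fin inj down cols], of "\<gamma> i"] i fin
    show ?thesis by (simp add: A_def A'_def)
  qed
  have fin': "finite (A r)" "finite (A' r)" for r using fin by (auto simp: A_def A'_def)
  have "card (A (\<rho> i)) < card (A (Suc (\<rho> i)))"
    by (rule psubset_card_mono[OF fin'(1)]) (use i in \<open>auto simp: A_def\<close>)
  then have "\<not> A' (Suc (\<rho> i)) \<subseteq> A' (\<rho> i)"
    unfolding eq using card_mono[OF fin'(2)] by (metis leD)
  then show ?thesis by (force simp: A'_def less_Suc_eq)
qed

section \<open>Row and column groups as stabilizers of labellings\<close>

definition sym_stab :: "nat \<Rightarrow> (nat \<Rightarrow> 'a) \<Rightarrow> (nat \<Rightarrow> nat) set" where
  "sym_stab n f = {p \<in> sym_grp n. \<forall>k<n. f (p k) = f k}"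

lemma row_group_eq: "row_group n \<nu> = sym_stab n (tab_row \<nu>)"
  by (simp add: row_group_def sym_stab_def sym_grp_def)

lemma col_group_eq: "col_group n \<nu> = sym_stab n (tab_col \<nu>)"
  by (simp add: col_group_def sym_stab_def sym_grp_def)

lemma sym_stab_sym_grp: "p \<in> sym_stab n f \<Longrightarrow> p \<in> sym_grp n"
  by (simp add: sym_stab_def)

lemma sym_stab_id [simp]: "id \<in> sym_stab n f"
  by (simp add: sym_stab_def)

lemma sym_stab_comp [simp]: "p \<in> sym_stab n f \<Longrightarrow> q \<in> sym_stab n f \<Longrightarrow> p \<circ> q \<in> sym_stab n f"
  by (auto simp: sym_stab_def)

lemma sym_stab_inv: "p \<in> sym_stab n f \<Longrightarrow> inv p \<in> sym_stab n f"
  by (auto simp: sym_stab_def) (metis sym_grp_apply(2) sym_grp_inv sym_grp_less)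

lemma sym_stab_inv_iff [simp]: "p \<in> sym_grp n \<Longrightarrow> inv p \<in> sym_stab n f \<longleftrightarrow> p \<in> sym_stab n f"
  by (metis sym_stab_inv sym_grp_inv_o(5))

lemma sym_stab_comp_iff [simp]:
  assumes "p \<in> sym_stab n f" "g \<in> sym_grp n"
  shows "p \<circ> g \<in> sym_stab n f \<longleftrightarrow> g \<in> sym_stab n f" "g \<circ> p \<in> sym_stab n f \<longleftrightarrow> g \<in> sym_stab n f"
proof -
  have p: "p \<in> sym_grp n" "inv p \<in> sym_stab n f" using assms sym_stab_inv sym_stab_sym_grp by blast+
  show "p \<circ> g \<in> sym_stab n f \<longleftrightarrow> g \<in> sym_stab n f"
    using sym_stab_comp[OF p(2), of "p \<circ> g"] sym_stab_comp[OF assms(1)]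
    unfolding sym_grp_inv_o(3)[OF p(1)] by blast
  show "g \<circ> p \<in> sym_stab n f \<longleftrightarrow> g \<in> sym_stab n f"
    using sym_stab_comp[OF _ p(2), of "g \<circ> p"] sym_stab_comp[OF _ assms(1)]
    unfolding comp_assoc sym_grp_inv_o(2)[OF p(1)] comp_id by blast
qed

lemma transpose_sym_stab:
  assumes "i < n" "j < n" "f i = f j"
  shows "transpose i j \<in> sym_stab n f"
  using assms by (auto simp: sym_stab_def sym_grp_def permutes_swap_id transpose_def)

text \<open>With a the row sum of \<nu> and b the signed column sum of \<nu>', these are the
  elements of the form a x b. Two shapes are allowed at once: different ones serve orthogonality,
  equal ones primitivity.\<close>

definition bi_inv :: "nat \<Rightarrow> nat list \<Rightarrow> nat list \<Rightarrow> ((nat \<Rightarrow> nat) \<Rightarrow> complex) \<Rightarrow> bool" where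
  "bi_inv n \<nu> \<nu>' y \<longleftrightarrow> y \<in> group_algebra n \<and>
     (\<forall>g\<in>sym_grp n. (\<forall>p\<in>row_group n \<nu>. y (p \<circ> g) = y g) \<and>
        (\<forall>q\<in>col_group n \<nu>'. y (g \<circ> q) = of_int (sign q) * y g))"

text \<open>The transposition trick: two points sharing a row of \<nu> and, after
  \<open>inv g\<close>, a column of \<nu>' give a row transposition \<open>?t\<close> and a column
  transposition \<open>?t'\<close> with \<open>?t \<circ> g = g \<circ> ?t'\<close>. Row invariance
  and the sign of \<open>?t'\<close> then force \<open>y g = - y g\<close>.\<close>

lemma bi_inv_vanish:
  assumes y: "bi_inv n \<nu> \<nu>' y" and g: "g \<in> sym_grp n"
    and ninj: "\<not> inj_on (\<lambda>i. (tab_row \<nu> i, tab_col \<nu>' (inv g i))) {..<n}"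
  shows "y g = 0"
proof -
  from ninj obtain i j where ij: "i < n" "j < n" "i \<noteq> j" "tab_row \<nu> i = tab_row \<nu> j"
    "tab_col \<nu>' (inv g i) = tab_col \<nu>' (inv g j)"
    unfolding inj_on_def by blast
  let ?t = "transpose i j" and ?t' = "transpose (inv g i) (inv g j)"
  have t: "?t \<in> row_group n \<nu>" unfolding row_group_eq by (rule transpose_sym_stab) (use ij in auto)
  have t': "?t' \<in> col_group n \<nu>'"
    unfolding col_group_eq by (rule transpose_sym_stab) (use ij g in auto)
  have ne: "inv g i \<noteq> inv g j" using ij g by (metis sym_grp_apply(2))
  have "?t \<circ> g = g \<circ> ?t'"
  proof
    fix x
    have "g x = k \<longleftrightarrow> x = inv g k" for k using sym_grp_apply[OF g] by metis
    then show "(?t \<circ> g) x = (g \<circ> ?t') x" using g by (simp add: transpose_def)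
  qed
  then have "y g = y (g \<circ> ?t')" using y t g by (metis bi_inv_def)
  also have "\<dots> = - y g" using y t' g ne by (simp add: bi_inv_def sign_swap_id)
  finally show ?thesis by simp
qed

lemma card_columns_perm:
  assumes "g \<in> sym_grp n"
  shows "card {i \<in> {..<n}. f (inv g i) = c} = card {j \<in> {..<n}. f j = c}"
  by (rule bij_betw_same_card[of "inv g"], rule bij_betw_byWitness[of _ g])
     (use assms in auto)

text \<open>If the transposition trick failed at some \<open>g\<close>, the rows of \<nu> and the
  columns of \<nu>' taken along \<open>inv g\<close> would form a filling to which
  \<open>card_rows_le\<close> applies, bounding the partial sums of \<nu> by those of
  \<nu>'.\<close>

lemma bi_inv_dominated:
  assumes y: "bi_inv n \<nu> \<nu>' y" and \<nu>: "is_partition n \<nu>" and \<nu>': "is_partition n \<nu>'"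
    and r: "sum_list (take r \<nu>') < sum_list (take r \<nu>)"
  shows "y = 0"
proof (rule group_algebra_eqI)
  show "y \<in> group_algebra n" using y by (simp add: bi_inv_def)
  show "0 \<in> group_algebra n" by (simp add: group_algebra_iff)
  fix g assume g: "g \<in> sym_grp n"
  have "\<not> inj_on (\<lambda>i. (tab_row \<nu> i, tab_col \<nu>' (inv g i))) {..<n}"
  proof
    assume inj: "inj_on (\<lambda>i. (tab_row \<nu> i, tab_col \<nu>' (inv g i))) {..<n}"
    have "card {i \<in> {..<n}. tab_row \<nu> i < r} \<le> card {j \<in> {..<n}. tab_row \<nu>' j < r}"
      by (rule card_rows_le[OF _ _ inj, of _ _ "tab_col \<nu>'"])
         (use \<nu>' tab_column_downward[of \<nu>'] card_columns_perm[OF g]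
          in \<open>auto simp: is_partition_def Bex_def\<close>)
    then show False
      using r card_tab_row_less[of \<nu> r] card_tab_row_less[of \<nu>' r] \<nu> \<nu>'
      by (simp add: is_partition_def)
  qed
  then show "y g = 0 g" using bi_inv_vanish[OF y g] by simp
qed

text \<open>Counting provides, for each \<open>i\<close>, a cell in the row of \<open>i\<close> and
  the column of \<open>inv g i\<close>. Sending each \<open>i\<close> there is a row permutation,
  and its composite with \<open>g\<close> preserves columns.\<close>

lemma row_col_factor:
  assumes g: "g \<in> sym_grp n" and \<nu>: "is_partition n \<nu>"
    and inj: "inj_on (\<lambda>i. (tab_row \<nu> i, tab_col \<nu> (inv g i))) {..<n}"
  shows "\<exists>p\<in>row_group n \<nu>. \<exists>q\<in>col_group n \<nu>. g = p \<circ> q"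
proof -
  have ex: "\<exists>j\<in>{..<n}. tab_row \<nu> j = tab_row \<nu> i \<and> tab_col \<nu> j = tab_col \<nu> (inv g i)"
    if "i \<in> {..<n}" for i
    by (rule rows_columns_cell[OF _ _ inj, of _ _ "tab_col \<nu>"])
       (use that \<nu> tab_column_downward[of \<nu>] card_columns_perm[OF g]
        in \<open>auto simp: is_partition_def Bex_def\<close>)
  have "\<exists>P. \<forall>i\<in>{..<n}. P i \<in> {..<n} \<and> tab_row \<nu> (P i) = tab_row \<nu> i
      \<and> tab_col \<nu> (P i) = tab_col \<nu> (inv g i)"
    using ex by (intro bchoice) blast
  then obtain P where P: "\<And>i. i < n \<Longrightarrow> P i < n"
    "\<And>i. i < n \<Longrightarrow> tab_row \<nu> (P i) = tab_row \<nu> i"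
    "\<And>i. i < n \<Longrightarrow> tab_col \<nu> (P i) = tab_col \<nu> (inv g i)"
    by auto
  define p where "p = (\<lambda>i. if i < n then P i else i)"
  have "p permutes {..<n}"
  proof (rule inj_imp_permutes)
    show "inj_on p {..<n}"
    proof (rule inj_onI)
      fix x y assume xy: "x \<in> {..<n}" "y \<in> {..<n}" "p x = p y"
      then have "P x = P y" by (simp add: p_def)
      then have "(tab_row \<nu> x, tab_col \<nu> (inv g x)) = (tab_row \<nu> y, tab_col \<nu> (inv g y))"
        using P(2,3)[of x] P(2,3)[of y] xy by simp
      then show "x = y" using inj_onD[OF inj] xy by blast
    qed
  qed (use P(1) in \<open>simp_all add: p_def\<close>)
  then have p: "p \<in> sym_grp n" by (simp add: sym_grp_def)
  have "p \<in> row_group n \<nu>" using p P(2) by (simp add: row_group_eq sym_stab_def p_def)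
  then have ip: "inv p \<in> row_group n \<nu>" by (simp add: row_group_eq sym_stab_inv)
  have "tab_col \<nu> (p (g k)) = tab_col \<nu> k" if "k < n" for k
    using P(3)[of "g k"] g that by (simp add: p_def)
  then have pg: "p \<circ> g \<in> col_group n \<nu>" using p g by (simp add: col_group_eq sym_stab_def)
  have "g = inv p \<circ> (p \<circ> g)" using p by simp
  then show ?thesis using ip pg by blast
qed

lemma row_col_group_Int:
  assumes \<nu>: "is_partition n \<nu>" and p: "p \<in> row_group n \<nu>" "p \<in> col_group n \<nu>"
  shows "p = id"
proof
  fix i
  have pn: "p permutes {..<n}" using p by (simp add: row_group_def)
  show "p i = id i"
  proof (cases "i < n")
    case True
    then show ?thesis
      using inj_onD[OF inj_on_tab_row_col[of \<nu>], of "p i" i] p \<nu> permutes_in_image[OF pn, of i]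
      by (auto simp: row_group_def col_group_def is_partition_def)
  next
    case False
    then show ?thesis using permutes_not_in[OF pn] by simp
  qed
qed

section \<open>Young symmetrizers and their symmetrized form\<close>

abbreviation row_sum :: "nat \<Rightarrow> nat list \<Rightarrow> (nat \<Rightarrow> nat) \<Rightarrow> complex" where
  "row_sum n \<nu> \<equiv> \<lambda>p. if p \<in> row_group n \<nu> then 1 else 0"

abbreviation col_sum :: "nat \<Rightarrow> nat list \<Rightarrow> (nat \<Rightarrow> nat) \<Rightarrow> complex" where
  "col_sum n \<nu> \<equiv> \<lambda>p. if p \<in> col_group n \<nu> then of_int (sign p) else 0"

lemma ga_mult_left_scale:
  assumes "\<And>g. g \<in> sym_grp n \<Longrightarrow> x (p \<circ> g) = s * x g" "p \<in> sym_grp n" "g \<in> sym_grp n"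
  shows "ga_mult n x y (p \<circ> g) = s * ga_mult n x y g"
  using assms by (simp add: ga_mult_eq_right comp_assoc sum_distrib_left mult.assoc cong: sum.cong)

lemma ga_mult_right_scale:
  assumes "\<And>g. g \<in> sym_grp n \<Longrightarrow> y (g \<circ> q) = s * y g" "q \<in> sym_grp n" "g \<in> sym_grp n"
  shows "ga_mult n x y (g \<circ> q) = s * ga_mult n x y g"
  using assms
  by (simp add: ga_mult_eq sum_distrib_left mult.left_commute flip: comp_assoc cong: sum.cong)

lemma young_left:
  assumes "p \<in> row_group n \<nu>" "g \<in> sym_grp n"
  shows "young_symmetrizer n \<nu> (p \<circ> g) = young_symmetrizer n \<nu> g"
  using ga_mult_left_scale[of n "row_sum n \<nu>" p 1 g] assms
  by (simp add: young_symmetrizer_def row_group_eq sym_stab_sym_grp)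

lemma young_right:
  assumes "q \<in> col_group n \<nu>" "g \<in> sym_grp n"
  shows "young_symmetrizer n \<nu> (g \<circ> q) = of_int (sign q) * young_symmetrizer n \<nu> g"
  unfolding young_symmetrizer_def
proof (rule ga_mult_right_scale)
  show q: "q \<in> sym_grp n" using assms by (simp add: col_group_eq sym_stab_sym_grp)
  show "col_sum n \<nu> (h \<circ> q) = of_int (sign q) * col_sum n \<nu> h" if "h \<in> sym_grp n" for h
    using that q assms by (simp add: col_group_eq sym_grp_sign_comp)
qed (rule assms)

lemma bi_inv_young_sandwich:
  "bi_inv n \<nu> \<nu>' (ga_mult n (ga_mult n (young_symmetrizer n \<nu>) x) (young_symmetrizer n \<nu>'))"
  unfolding bi_inv_def
proof (intro conjI ballI)
  fix g p assume gp: "g \<in> sym_grp n" "p \<in> row_group n \<nu>"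
  show "ga_mult n (ga_mult n (young_symmetrizer n \<nu>) x) (young_symmetrizer n \<nu>') (p \<circ> g)
      = ga_mult n (ga_mult n (young_symmetrizer n \<nu>) x) (young_symmetrizer n \<nu>') g"
    unfolding ga_mult_assoc
    using ga_mult_left_scale[of n "young_symmetrizer n \<nu>" p 1 g] young_left gp
    by (simp add: row_group_eq sym_stab_sym_grp)
next
  fix g q assume gq: "g \<in> sym_grp n" "q \<in> col_group n \<nu>'"
  show "ga_mult n (ga_mult n (young_symmetrizer n \<nu>) x) (young_symmetrizer n \<nu>') (g \<circ> q)
      = of_int (sign q) * ga_mult n (ga_mult n (young_symmetrizer n \<nu>) x) (young_symmetrizer n \<nu>') g"
    by (rule ga_mult_right_scale) (use young_right gq in \<open>auto simp: col_group_eq sym_stab_sym_grp\<close>)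
qed simp

text \<open>A row permutation times a column permutation is the identity only if both are, so a
  single term of the convolution survives. The value 1 normalizes the scalar in
  \<open>bi_inv_young\<close>.\<close>

lemma young_id:
  assumes "is_partition n \<nu>"
  shows "young_symmetrizer n \<nu> id = 1"
proof -
  have "young_symmetrizer n \<nu> id = (\<Sum>q\<in>sym_grp n. row_sum n \<nu> q * col_sum n \<nu> (inv q))"
    by (simp add: young_symmetrizer_def ga_mult_eq del: o_apply cong: if_cong)
  also have "\<dots> = (\<Sum>q\<in>sym_grp n. if q = id then 1 else 0)"
  proof (rule sum.cong[OF refl])
    fix q assume q: "q \<in> sym_grp n"
    have "q \<in> row_group n \<nu> \<and> inv q \<in> col_group n \<nu> \<longleftrightarrow> q = id"
      using row_col_group_Int[OF assms, of q] q by (auto simp: row_group_eq col_group_eq)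
    then show "row_sum n \<nu> q * col_sum n \<nu> (inv q) = (if q = id then 1 else 0)" by auto
  qed
  finally show ?thesis by simp
qed

text \<open>Both sides vanish off the products \<open>p q\<close> of row and column permutations, and on these they are
  determined by their value at the identity.\<close>

lemma bi_inv_young:
  assumes \<nu>: "is_partition n \<nu>" and y: "bi_inv n \<nu> \<nu> y"
  shows "y = cscale (y id) (young_symmetrizer n \<nu>)"
proof (rule group_algebra_eqI[where n = n])
  let ?e = "young_symmetrizer n \<nu>"
  have e: "bi_inv n \<nu> \<nu> ?e"
    using young_left young_right by (auto simp: bi_inv_def) (simp add: young_symmetrizer_def)
  show "y \<in> group_algebra n" using y by (simp add: bi_inv_def)
  have "?e \<in> group_algebra n" using e by (simp add: bi_inv_def)
  then show "cscale (y id) ?e \<in> group_algebra n" by (simp add: group_algebra_iff cscale_def)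
  fix g assume g: "g \<in> sym_grp n"
  show "y g = cscale (y id) ?e g"
  proof (cases "inj_on (\<lambda>i. (tab_row \<nu> i, tab_col \<nu> (inv g i))) {..<n}")
    case True
    then obtain p q where pq: "p \<in> row_group n \<nu>" "q \<in> col_group n \<nu>" "g = p \<circ> q"
      using row_col_factor[OF g \<nu>] by blast
    then have q: "q \<in> sym_grp n" by (simp add: col_group_eq sym_stab_sym_grp)
    have "x g = of_int (sign q) * x id" if "bi_inv n \<nu> \<nu> x" for x
      using that pq q by (metis bi_inv_def comp_id id_comp sym_grp_id)
    from this[OF y] this[OF e] show ?thesis by (simp add: cscale_def young_id[OF \<nu>])
  next
    case False
    then show ?thesis using bi_inv_vanish[OF y g False] bi_inv_vanish[OF e g False]
      by (simp add: cscale_def)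
  qed
qed

text \<open>With a the row sum and b the signed column sum this is a b a. The trailing a gives
  symmetry under inversion, which a b lacks in general.\<close>

definition young_sym :: "nat \<Rightarrow> nat list \<Rightarrow> (nat \<Rightarrow> nat) \<Rightarrow> complex" where
  "young_sym n \<nu> = ga_mult n (young_symmetrizer n \<nu>) (row_sum n \<nu>)"

lemma ga_mult_inv:
  assumes "\<And>g. g \<in> sym_grp n \<Longrightarrow> x' g = x (inv g)" "\<And>g. g \<in> sym_grp n \<Longrightarrow> y' g = y (inv g)"
    and g: "g \<in> sym_grp n"
  shows "ga_mult n x y (inv g) = ga_mult n y' x' g"
proof -
  have "ga_mult n x y (inv g) = (\<Sum>q\<in>sym_grp n. x q * y (inv q \<circ> inv g))"
    using g by (simp add: ga_mult_eq)
  also have "\<dots> = (\<Sum>q\<in>sym_grp n. x (inv q) * y (q \<circ> inv g))"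
    using sum_sym_grp_inv[of "\<lambda>q. x q * y (inv q \<circ> inv g)" n] by (simp cong: sum.cong)
  also have "\<dots> = ga_mult n y' x' g"
    using g by (simp add: ga_mult_eq_right assms(1,2) mult.commute cong: sum.cong)
  finally show ?thesis .
qed

text \<open>Inversion of group elements reverses products and fixes the row sum and the signed
  column sum, hence also the palindrome a b a.\<close>

lemma young_sym_inv:
  assumes "g \<in> sym_grp n"
  shows "young_sym n \<nu> (inv g) = young_sym n \<nu> g"
proof -
  have a: "row_sum n \<nu> g = row_sum n \<nu> (inv g)" if "g \<in> sym_grp n" for g
    using that by (simp add: row_group_eq)
  have b: "col_sum n \<nu> g = col_sum n \<nu> (inv g)" if "g \<in> sym_grp n" for g
    using that by (simp add: col_group_eq sym_grp_sign_inv)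
  have "young_sym n \<nu> (inv g)
      = ga_mult n (row_sum n \<nu>) (ga_mult n (col_sum n \<nu>) (row_sum n \<nu>)) g"
    unfolding young_sym_def
  proof (rule ga_mult_inv)
    show "g \<in> sym_grp n" by (rule assms)
    show "row_sum n \<nu> h = row_sum n \<nu> (inv h)" if "h \<in> sym_grp n" for h by (rule a[OF that])
    fix h assume h: "h \<in> sym_grp n"
    show "ga_mult n (col_sum n \<nu>) (row_sum n \<nu>) h = young_symmetrizer n \<nu> (inv h)"
      unfolding young_symmetrizer_def by (intro ga_mult_inv[symmetric] a b h)
  qed
  then show ?thesis by (simp add: young_sym_def young_symmetrizer_def ga_mult_assoc)
qed

text \<open>Splitting off the last row sum leaves e (a x) e, which is bi-invariant and thus a
  multiple of e by \<open>bi_inv_young\<close>.\<close>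

lemma young_sym_sandwich:
  assumes "is_partition n \<nu>"
  shows "\<exists>k. ga_mult n (ga_mult n (young_sym n \<nu>) x) (young_sym n \<nu>) = cscale k (young_sym n \<nu>)"
proof -
  let ?e = "young_symmetrizer n \<nu>" and ?a = "row_sum n \<nu>"
  let ?y = "ga_mult n (ga_mult n ?e (ga_mult n ?a x)) ?e"
  have "?y = cscale (?y id) ?e" by (rule bi_inv_young[OF assms bi_inv_young_sandwich])
  then have "ga_mult n ?y ?a = cscale (?y id) (young_sym n \<nu>)"
    unfolding young_sym_def by (metis ga_mult_linear(3))
  then show ?thesis by (auto simp: young_sym_def ga_mult_assoc)
qed

text \<open>The same splitting, where the bi-invariant element now vanishes by dominance.\<close>

lemma young_sym_orthogonal:
  assumes "is_partition n \<nu>" "is_partition n \<nu>'" "sum_list (take r \<nu>') < sum_list (take r \<nu>)"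
  shows "ga_mult n (ga_mult n (young_sym n \<nu>) x) (young_sym n \<nu>') = 0"
proof -
  let ?e = "young_symmetrizer n"
  have "ga_mult n (ga_mult n (?e \<nu>) (ga_mult n (row_sum n \<nu>) x)) (?e \<nu>') = 0"
    by (rule bi_inv_dominated[OF bi_inv_young_sandwich assms])
  then have "ga_mult n (ga_mult n (ga_mult n (?e \<nu>) (ga_mult n (row_sum n \<nu>) x)) (?e \<nu>')) (row_sum n \<nu>') = 0"
    by (simp only: ga_mult_zero)
  then show ?thesis by (simp only: young_sym_def ga_mult_assoc)
qed

section \<open>Orthogonality and Frobenius--Schur indicators\<close>

text \<open>A symmetric multiple \<open>f\<close> of a primitive idempotent of the group algebra:
  the functional equation expresses that each \<open>f g f\<close> is a multiple of \<open>f\<close>.\<close>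

locale spherical =
  fixes n :: nat and f :: "(nat \<Rightarrow> nat) \<Rightarrow> complex" and \<kappa> \<tau> :: complex
  assumes f_inv: "g \<in> sym_grp n \<Longrightarrow> f (inv g) = f g"
    and f_sq: "g \<in> sym_grp n \<Longrightarrow> (\<Sum>h\<in>sym_grp n. f h * f (inv h \<circ> g)) = \<kappa> * f g"
    and f_fun: "g \<in> sym_grp n \<Longrightarrow> x \<in> sym_grp n \<Longrightarrow>
      (\<Sum>h\<in>sym_grp n. f h * f (inv g \<circ> inv h \<circ> x)) = \<tau> * f g * f x"
    and f_id: "\<tau> * f id = \<kappa>"
    and \<kappa>: "\<kappa> \<noteq> 0"
begin

text \<open>For \<open>f\<close> supported on the group, \<open>trace_on_left_ideal\<close> makes
  this the character of the left ideal generated by \<open>f\<close>; invariance of \<open>f\<close>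
  under inversion lets \<open>w\<close> replace \<open>inv w\<close>.\<close>

definition chi :: "(nat \<Rightarrow> nat) \<Rightarrow> complex" where
  "chi w = (\<Sum>g\<in>sym_grp n. f (inv g \<circ> w \<circ> g)) / \<kappa>"

lemma f_eqI: "g \<in> sym_grp n \<Longrightarrow> inv g = h \<Longrightarrow> f g = f h"
  using f_inv[of g] by simp

lemma sum_f_sq: "(\<Sum>g\<in>sym_grp n. f g * f g) = \<kappa> * f id"
  using f_sq[OF sym_grp_id] by (simp add: f_inv cong: sum.cong)

lemma chi_conj:
  assumes "h \<in> sym_grp n" "w \<in> sym_grp n"
  shows "chi (inv h \<circ> w \<circ> h) = chi w"
  using sum_sym_grp_left[OF assms(1), of "\<lambda>g. f (inv g \<circ> w \<circ> g)"] assms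
  by (simp add: chi_def comp_assoc cong: sum.cong)

text \<open>\<open>chi\<close> averages \<open>f\<close> over conjugates, and a class function does
  not see the conjugation. Pairings with \<open>chi\<close> thus reduce to pairings with
  \<open>f\<close>.\<close>

lemma sum_class_chi:
  assumes F: "\<And>w h. w \<in> sym_grp n \<Longrightarrow> h \<in> sym_grp n \<Longrightarrow> F (inv h \<circ> w \<circ> h) = F w"
  shows "(\<Sum>w\<in>sym_grp n. F w * chi w) = fact n / \<kappa> * (\<Sum>w\<in>sym_grp n. F w * f w)"
proof -
  have "(\<Sum>w\<in>sym_grp n. F w * chi w)
      = (\<Sum>g\<in>sym_grp n. \<Sum>w\<in>sym_grp n. F w * f (inv g \<circ> w \<circ> g)) / \<kappa>"
    by (subst sum.swap) (simp add: chi_def sum_divide_distrib sum_distrib_left)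
  also have "(\<Sum>g\<in>sym_grp n. \<Sum>w\<in>sym_grp n. F w * f (inv g \<circ> w \<circ> g))
      = (\<Sum>g\<in>sym_grp n. \<Sum>w\<in>sym_grp n. F w * f w)"
  proof (rule sum.cong[OF refl])
    fix g assume g: "g \<in> sym_grp n"
    have "(\<Sum>w\<in>sym_grp n. F w * f (inv g \<circ> w \<circ> g))
        = (\<Sum>w\<in>sym_grp n. F (inv g \<circ> w \<circ> g) * f (inv g \<circ> w \<circ> g))"
      using F g by (intro sum.cong) auto
    then show "(\<Sum>w\<in>sym_grp n. F w * f (inv g \<circ> w \<circ> g)) = (\<Sum>w\<in>sym_grp n. F w * f w)"
      using sum_sym_grp_conj[OF g, of "\<lambda>w. F w * f w"] by simp
  qed
  also have "\<dots> = fact n * (\<Sum>w\<in>sym_grp n. F w * f w)"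
    by (simp add: card_sym_grp)
  finally show ?thesis by simp
qed

text \<open>After reduction to a pairing with \<open>f\<close>, inverting the argument of one factor
  puts the inner sum into the form of \<open>f_fun\<close> with \<open>x = g\<close>; its values are
  summed by \<open>sum_f_sq\<close>.\<close>

lemma chi_norm: "(\<Sum>w\<in>sym_grp n. chi w * chi w) = fact n"
proof -
  have "(\<Sum>w\<in>sym_grp n. chi w * f w)
      = (\<Sum>g\<in>sym_grp n. \<Sum>w\<in>sym_grp n. f w * f (inv g \<circ> w \<circ> g)) / \<kappa>"
    by (subst sum.swap) (simp add: chi_def sum_divide_distrib sum_distrib_left mult.commute)
  also have "(\<Sum>g\<in>sym_grp n. \<Sum>w\<in>sym_grp n. f w * f (inv g \<circ> w \<circ> g))
      = (\<Sum>g\<in>sym_grp n. \<tau> * f g * f g)"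
  proof (rule sum.cong[OF refl])
    fix g assume g: "g \<in> sym_grp n"
    have "f w * f (inv g \<circ> w \<circ> g) = f w * f (inv g \<circ> inv w \<circ> g)" if "w \<in> sym_grp n" for w
      by (rule arg_cong[where f = "(*) (f w)"], rule f_eqI)
         (use g that in \<open>simp_all add: comp_assoc sym_grp_inv_comp[of _ n]\<close>)
    then have "(\<Sum>w\<in>sym_grp n. f w * f (inv g \<circ> w \<circ> g))
        = (\<Sum>w\<in>sym_grp n. f w * f (inv g \<circ> inv w \<circ> g))" by (rule sum.cong[OF refl])
    then show "(\<Sum>w\<in>sym_grp n. f w * f (inv g \<circ> w \<circ> g)) = \<tau> * f g * f g"
      by (simp only: f_fun[OF g g])
  qed
  also have "\<dots> = \<tau> * (\<kappa> * f id)" by (simp add: mult.assoc sum_f_sq flip: sum_distrib_left)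
  also have "\<dots> = \<kappa> * \<kappa>" using f_id by (simp add: mult.left_commute)
  finally show ?thesis using sum_class_chi[of chi] chi_conj \<kappa> by simp
qed

text \<open>The Frobenius--Schur indicator is 1: substitute \<open>x = g\<^sup>-\<^sup>1\<close> in the functional equation and
  sum over \<open>g\<close>.\<close>

lemma sum_f_square: "(\<Sum>v\<in>sym_grp n. f (v \<circ> v)) = \<kappa>"
proof -
  \<comment> \<open>By \<open>f_sq\<close> the factor \<kappa> is traded for a second sum over
    \<open>g\<close>. Shifting \<open>g\<close> by \<open>h\<close> and then \<open>h\<close> by
    \<open>g\<close> separates the two copies of \<open>h\<close> and produces the sum in
    \<open>f_fun\<close>.\<close>
  have "\<kappa> * (\<Sum>h\<in>sym_grp n. f (h \<circ> h))
      = (\<Sum>h\<in>sym_grp n. \<Sum>g\<in>sym_grp n. f g * f (inv g \<circ> (h \<circ> h)))"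
    by (simp add: sum_distrib_left f_sq)
  also have "\<dots> = (\<Sum>h\<in>sym_grp n. \<Sum>g\<in>sym_grp n. f (h \<circ> g) * f (inv h \<circ> g))"
  proof (rule sum.cong[OF refl])
    fix h assume h: "h \<in> sym_grp n"
    have "f (inv g \<circ> (h \<circ> h)) = f (inv h \<circ> (inv h \<circ> g))" if "g \<in> sym_grp n" for g
      by (rule f_eqI) (use h that in \<open>simp_all add: comp_assoc sym_grp_inv_comp[of _ n]\<close>)
    then have "(\<Sum>g\<in>sym_grp n. f g * f (inv g \<circ> (h \<circ> h)))
        = (\<Sum>g\<in>sym_grp n. f g * f (inv h \<circ> (inv h \<circ> g)))" by simp
    also have "\<dots> = (\<Sum>g\<in>sym_grp n. f (h \<circ> g) * f (inv h \<circ> g))"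
      using sum_sym_grp_left[OF h, of "\<lambda>g. f g * f (inv h \<circ> (inv h \<circ> g))"] h by simp
    finally show "(\<Sum>g\<in>sym_grp n. f g * f (inv g \<circ> (h \<circ> h)))
        = (\<Sum>g\<in>sym_grp n. f (h \<circ> g) * f (inv h \<circ> g))" .
  qed
  also have "\<dots> = (\<Sum>g\<in>sym_grp n. \<Sum>h\<in>sym_grp n. f (h \<circ> g) * f (inv h \<circ> g))"
    by (rule sum.swap)
  also have "\<dots> = (\<Sum>g\<in>sym_grp n. \<Sum>h\<in>sym_grp n. f h * f (g \<circ> inv h \<circ> g))"
  proof (rule sum.cong[OF refl])
    fix g assume g: "g \<in> sym_grp n"
    show "(\<Sum>h\<in>sym_grp n. f (h \<circ> g) * f (inv h \<circ> g))
        = (\<Sum>h\<in>sym_grp n. f h * f (g \<circ> inv h \<circ> g))"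
      using sum_sym_grp_right[OF g, of "\<lambda>h. f h * f (g \<circ> inv h \<circ> g)"] g
      by (simp add: comp_assoc cong: sum.cong)
  qed
  also have "\<dots> = (\<Sum>g\<in>sym_grp n. \<tau> * f g * f g)"
  proof (rule sum.cong[OF refl])
    fix g assume g: "g \<in> sym_grp n"
    show "(\<Sum>h\<in>sym_grp n. f h * f (g \<circ> inv h \<circ> g)) = \<tau> * f g * f g"
      using f_fun[of "inv g" g] g f_inv[OF g] by simp
  qed
  also have "\<dots> = \<tau> * (\<kappa> * f id)" by (simp add: mult.assoc sum_f_sq flip: sum_distrib_left)
  also have "\<dots> = \<kappa> * \<kappa>" using f_id by (simp add: mult.left_commute)
  finally show ?thesis using \<kappa> by simp
qed

text \<open>Conjugation commutes with squaring, so each conjugate of \<open>f\<close> in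
  \<open>chi\<close> contributes \<kappa>.\<close>

lemma chi_indicator: "(\<Sum>v\<in>sym_grp n. chi (v \<circ> v)) = fact n"
proof -
  have "(\<Sum>v\<in>sym_grp n. chi (v \<circ> v))
      = (\<Sum>g\<in>sym_grp n. \<Sum>v\<in>sym_grp n. f (inv g \<circ> (v \<circ> v) \<circ> g)) / \<kappa>"
    by (subst sum.swap) (simp add: chi_def sum_divide_distrib)
  also have "(\<Sum>g\<in>sym_grp n. \<Sum>v\<in>sym_grp n. f (inv g \<circ> (v \<circ> v) \<circ> g))
      = (\<Sum>g\<in>sym_grp n. \<kappa>)"
  proof (rule sum.cong[OF refl])
    fix g assume g: "g \<in> sym_grp n"
    have "inv g \<circ> (v \<circ> v) \<circ> g = (inv g \<circ> v \<circ> g) \<circ> (inv g \<circ> v \<circ> g)" for v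
      using g by (simp add: comp_assoc)
    then show "(\<Sum>v\<in>sym_grp n. f (inv g \<circ> (v \<circ> v) \<circ> g)) = \<kappa>"
      using sum_sym_grp_conj[OF g, of "\<lambda>v. f (v \<circ> v)"] sum_f_square by (simp only:)
  qed
  also have "(\<Sum>g\<in>sym_grp n. \<kappa>) = fact n * \<kappa>" by (simp add: card_sym_grp)
  finally show ?thesis by (simp only: nonzero_mult_div_cancel_right[OF \<kappa>])
qed

end

text \<open>The pairing reduces to one with \<open>f\<close> as in \<open>chi_norm\<close>; for each
  \<open>g\<close> the inner sum is the coefficient at \<open>g\<close> of the product f g f', which
  vanishes.\<close>

lemma spherical_orthogonal:
  assumes "spherical n f \<kappa> \<tau>" "spherical n f' \<kappa>' \<tau>'"
    and 0: "\<And>g. g \<in> sym_grp n \<Longrightarrow> ga_mult n (ga_mult n f (ga_of g)) f' = 0"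
  shows "(\<Sum>w\<in>sym_grp n. spherical.chi n f \<kappa> w * spherical.chi n f' \<kappa>' w) = 0"
proof -
  interpret F: spherical n f \<kappa> \<tau> by fact
  interpret F': spherical n f' \<kappa>' \<tau>' by fact
  have "(\<Sum>w\<in>sym_grp n. F'.chi w * f w)
      = (\<Sum>g\<in>sym_grp n. \<Sum>w\<in>sym_grp n. f w * f' (inv g \<circ> w \<circ> g)) / \<kappa>'"
    by (subst sum.swap) (simp add: F'.chi_def sum_divide_distrib sum_distrib_left mult.commute)
  also have "(\<Sum>g\<in>sym_grp n. \<Sum>w\<in>sym_grp n. f w * f' (inv g \<circ> w \<circ> g)) = (\<Sum>g\<in>sym_grp n. 0)"
  proof (rule sum.cong[OF refl])
    fix g assume g: "g \<in> sym_grp n"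
    have "f' (inv g \<circ> w \<circ> g) = f' (inv g \<circ> (inv w \<circ> g))" if "w \<in> sym_grp n" for w
      by (rule F'.f_eqI) (use g that in \<open>simp_all add: comp_assoc sym_grp_inv_comp[of _ n]\<close>)
    then have "f' (inv g \<circ> w \<circ> g) = ga_mult n (ga_of g) f' (inv w \<circ> g)" if "w \<in> sym_grp n" for w
      using g that by (simp add: ga_mult_ga_of)
    then have "(\<Sum>w\<in>sym_grp n. f w * f' (inv g \<circ> w \<circ> g)) = ga_mult n f (ga_mult n (ga_of g) f') g"
      using g by (simp add: ga_mult_eq[of n f])
    then show "(\<Sum>w\<in>sym_grp n. f w * f' (inv g \<circ> w \<circ> g)) = 0"
      using 0[OF g] by (simp add: ga_mult_assoc)
  qed
  finally have "(\<Sum>w\<in>sym_grp n. F'.chi w * F.chi w) = 0"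
    using F.sum_class_chi[of F'.chi] F'.chi_conj by simp
  then show ?thesis by (simp add: mult.commute)
qed

section \<open>Primitivity and nonvanishing of a b a\<close>

lemma row_group_subset: "row_group n \<nu> \<subseteq> sym_grp n"
  by (auto simp: row_group_eq sym_stab_sym_grp)

lemma finite_row_group [simp]: "finite (row_group n \<nu>)"
  by (rule finite_subset[OF row_group_subset finite_sym_grp])

lemma card_row_group: "card (row_group n \<nu>) \<noteq> 0"
  using sym_stab_id[of n "tab_row \<nu>"] by (auto simp: row_group_eq[symmetric])

lemma sum_row_sum: "(\<Sum>q\<in>sym_grp n. F q * row_sum n \<nu> q) = (\<Sum>q\<in>row_group n \<nu>. F q)"
  by (rule sum.mono_neutral_cong_right) (use row_group_subset in auto)

lemma young_sym_id:
  assumes "is_partition n \<nu>"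
  shows "young_sym n \<nu> id = of_nat (card (row_group n \<nu>))"
proof -
  have "young_sym n \<nu> id = (\<Sum>q\<in>row_group n \<nu>. young_symmetrizer n \<nu> (inv q))"
    by (simp add: young_sym_def ga_mult_eq_right sum_row_sum)
  also have "\<dots> = (\<Sum>q\<in>row_group n \<nu>. 1)"
  proof (rule sum.cong[OF refl])
    fix q assume "q \<in> row_group n \<nu>"
    then have "inv q \<in> row_group n \<nu>" by (simp add: row_group_eq sym_stab_inv)
    then show "young_symmetrizer n \<nu> (inv q) = 1"
      using young_left[of "inv q" n \<nu> id] young_id[OF assms] by simp
  qed
  finally show ?thesis by simp
qed

lemma ga_mult_real:
  assumes "\<And>g. g \<in> sym_grp n \<Longrightarrow> x g \<in> \<real>" "\<And>g. g \<in> sym_grp n \<Longrightarrow> y g \<in> \<real>"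
  shows "ga_mult n x y g \<in> \<real>"
  using assms by (auto simp: ga_mult_eq intro!: sum_in_Reals Reals_mult)

lemma young_sym_real: "young_sym n \<nu> g \<in> \<real>"
  unfolding young_sym_def young_symmetrizer_def by (intro ga_mult_real) auto

definition young_norm :: "nat \<Rightarrow> nat list \<Rightarrow> complex" where
  "young_norm n \<nu> = (SOME \<kappa>. ga_mult n (young_sym n \<nu>) (young_sym n \<nu>) = cscale \<kappa> (young_sym n \<nu>))"

lemma young_sym_idem:
  assumes "is_partition n \<nu>"
  shows "ga_mult n (young_sym n \<nu>) (young_sym n \<nu>) = cscale (young_norm n \<nu>) (young_sym n \<nu>)"
proof -
  have "young_sym n \<nu> \<in> group_algebra n" by (simp add: young_sym_def)
  then show ?thesis
    using young_sym_sandwich[OF assms, of "ga_of id"] unfolding young_norm_def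
    by (simp add: ga_mult_one) (rule someI_ex)
qed

text \<open>By inversion symmetry, the square of a b a has at the identity the sum of the squares of
  the coefficients of a b a. These are real, and the one at the identity is the order of the row
  group.\<close>

lemma young_norm_nonzero:
  assumes "is_partition n \<nu>"
  shows "young_norm n \<nu> \<noteq> 0"
proof
  let ?f = "young_sym n \<nu>"
  assume "young_norm n \<nu> = 0"
  then have "ga_mult n ?f ?f id = 0" using young_sym_idem[OF assms] by (simp add: cscale_def)
  then have "(\<Sum>g\<in>sym_grp n. ?f g * ?f g) = 0"
    by (simp add: ga_mult_eq young_sym_inv cong: sum.cong)
  moreover have "?f g * ?f g = of_real ((Re (?f g))\<^sup>2)" for g
    using young_sym_real[of n \<nu> g] by (auto elim!: Reals_cases simp: power2_eq_square)
  ultimately have "of_real (\<Sum>g\<in>sym_grp n. (Re (?f g))\<^sup>2) = (0::complex)" by simp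
  then have "(\<Sum>g\<in>sym_grp n. (Re (?f g))\<^sup>2) = 0" by (simp only: of_real_eq_0_iff)
  then have "Re (?f id) = 0" by (simp add: sum_nonneg_eq_0_iff)
  then show False using card_row_group[of n \<nu>] by (simp add: young_sym_id[OF assms])
qed

text \<open>Primitivity gives f g f = k f with k depending on \<open>g\<close>. Evaluation at the
  identity and inversion symmetry yield k f(id) = \<kappa> f(g), so k is a fixed multiple of f(g).
  This is the functional equation.\<close>

lemma spherical_young:
  assumes \<nu>: "is_partition n \<nu>"
  shows "spherical n (young_sym n \<nu>) (young_norm n \<nu>) (young_norm n \<nu> / of_nat (card (row_group n \<nu>)))"
proof
  let ?f = "young_sym n \<nu>" and ?\<kappa> = "young_norm n \<nu>"
  let ?\<tau> = "?\<kappa> / of_nat (card (row_group n \<nu>))"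
  fix g assume g: "g \<in> sym_grp n"
  show "?f (inv g) = ?f g" by (rule young_sym_inv[OF g])
  show sq: "(\<Sum>h\<in>sym_grp n. ?f h * ?f (inv h \<circ> g)) = ?\<kappa> * ?f g"
    using fun_cong[OF young_sym_idem[OF \<nu>], of g] g by (simp add: ga_mult_eq cscale_def)
  fix x assume x: "x \<in> sym_grp n"
  obtain k where k: "ga_mult n (ga_mult n ?f (ga_of g)) ?f = cscale k ?f"
    using young_sym_sandwich[OF \<nu>] by blast
  have conv: "(\<Sum>h\<in>sym_grp n. ?f h * ?f (inv g \<circ> inv h \<circ> y)) = k * ?f y" if "y \<in> sym_grp n" for y
    using fun_cong[OF k, of y] g that
    by (simp add: ga_mult_assoc ga_mult_eq[of n ?f] ga_mult_ga_of cscale_def comp_assoc cong: sum.cong)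
  have "k * ?f id = (\<Sum>h\<in>sym_grp n. ?f h * ?f (inv g \<circ> inv h))"
    using conv[of id] by simp
  also have "\<dots> = (\<Sum>h\<in>sym_grp n. ?f (inv h) * ?f (inv g \<circ> h))"
    using sum_sym_grp_inv[of "\<lambda>h. ?f h * ?f (inv g \<circ> inv h)" n] by (simp cong: sum.cong)
  also have "\<dots> = (\<Sum>h\<in>sym_grp n. ?f h * ?f (inv h \<circ> g))"
  proof (rule sum.cong[OF refl])
    fix h assume h: "h \<in> sym_grp n"
    have "inv (inv g \<circ> h) = inv h \<circ> g" using g h by (simp add: sym_grp_inv_comp[of _ n])
    then have "?f (inv g \<circ> h) = ?f (inv h \<circ> g)"
      using young_sym_inv[of "inv g \<circ> h" n \<nu>] g h by (metis sym_grp_comp sym_grp_inv)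
    then show "?f (inv h) * ?f (inv g \<circ> h) = ?f h * ?f (inv h \<circ> g)"
      using young_sym_inv[OF h, of \<nu>] by simp
  qed
  finally have "k = ?\<tau> * ?f g"
    using card_row_group[of n \<nu>] unfolding sq by (simp add: young_sym_id[OF \<nu>] field_simps)
  then show "(\<Sum>h\<in>sym_grp n. ?f h * ?f (inv g \<circ> inv h \<circ> x)) = ?\<tau> * ?f g * ?f x"
    using conv[OF x] by simp
next
  show "young_norm n \<nu> / of_nat (card (row_group n \<nu>)) * young_sym n \<nu> id = young_norm n \<nu>"
    using card_row_group[of n \<nu>] by (simp add: young_sym_id[OF \<nu>])
  show "young_norm n \<nu> \<noteq> 0" by (rule young_norm_nonzero[OF \<nu>])
qed

lemma row_sum_idem:
  "ga_mult n (row_sum n \<nu>) (row_sum n \<nu>) = cscale (of_nat (card (row_group n \<nu>))) (row_sum n \<nu>)"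
proof (rule group_algebra_eqI[where n = n])
  show "cscale (of_nat (card (row_group n \<nu>))) (row_sum n \<nu>) \<in> group_algebra n"
    using row_group_subset by (auto simp: group_algebra_iff cscale_def)
  fix g assume g: "g \<in> sym_grp n"
  have "ga_mult n (row_sum n \<nu>) (row_sum n \<nu>) g
      = (\<Sum>q\<in>row_group n \<nu>. row_sum n \<nu> (g \<circ> inv q))"
    using g by (simp only: ga_mult_eq_right sum_row_sum)
  also have "\<dots> = (\<Sum>q\<in>row_group n \<nu>. row_sum n \<nu> g)"
    using g by (intro sum.cong refl) (simp add: row_group_eq sym_stab_inv)
  finally show "ga_mult n (row_sum n \<nu>) (row_sum n \<nu>) g
      = cscale (of_nat (card (row_group n \<nu>))) (row_sum n \<nu>) g"
    by (simp add: cscale_def)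
qed simp

text \<open>The ideal is generated by e = a b, whereas \<open>chi\<close> is built from f = e a. In
  a conjugation average the last a moves to the front, where e absorbs it, so the averages differ by
  the order of the row group. So do the scalars in e e = c e and f f = \<kappa> f, and the factor
  cancels.\<close>

lemma irr_char_eq_chi:
  assumes \<nu>: "is_partition n \<nu>" and w: "w \<in> sym_grp n"
  shows "irr_char n \<nu> w = spherical.chi n (young_sym n \<nu>) (young_norm n \<nu>) w"
proof -
  let ?e = "young_symmetrizer n \<nu>" and ?f = "young_sym n \<nu>" and ?a = "row_sum n \<nu>"
  let ?m = "of_nat (card (row_group n \<nu>)) :: complex"
  interpret F: spherical n ?f "young_norm n \<nu>" "young_norm n \<nu> / ?m" by (rule spherical_young[OF \<nu>])
  have m: "?m \<noteq> 0" using card_row_group[of n \<nu>] by simp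
  obtain c where ee: "ga_mult n ?e ?e = cscale c ?e"
    using bi_inv_young[OF \<nu> bi_inv_young_sandwich[of n \<nu> \<nu> "ga_of id"]]
    by (metis ga_mult_one(2) young_symmetrizer_def ga_mult_in_group_algebra)
  have ae: "ga_mult n ?a ?e = cscale ?m ?e"
    by (simp only: young_symmetrizer_def row_sum_idem ga_mult_linear flip: ga_mult_assoc)
  have "ga_mult n ?f ?f = ga_mult n ?e (ga_mult n (ga_mult n ?a ?e) ?a)"
    by (simp only: young_sym_def ga_mult_assoc)
  also have "\<dots> = cscale ?m (ga_mult n (ga_mult n ?e ?e) ?a)"
    by (simp only: ae ga_mult_linear ga_mult_assoc)
  also have "\<dots> = cscale ?m (cscale c ?f)"
    by (simp only: ee ga_mult_linear young_sym_def)
  \<comment> \<open>The two scalars are compared at the identity, where f does not vanish.\<close>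
  finally have "cscale (young_norm n \<nu>) ?f id = cscale ?m (cscale c ?f) id"
    by (simp only: young_sym_idem[OF \<nu>])
  then have \<kappa>: "young_norm n \<nu> = ?m * c"
    using m by (simp add: cscale_def young_sym_id[OF \<nu>])
  have c: "c \<noteq> 0" using \<kappa> F.\<kappa> by auto
  have "irr_char n \<nu> w = (\<Sum>g\<in>sym_grp n. ?e (inv g \<circ> inv w \<circ> g)) / c"
    unfolding irr_char_def irrep_def by (rule trace_on_left_ideal[OF ee c w])
  moreover have "(\<Sum>g\<in>sym_grp n. ?f (inv g \<circ> w \<circ> g))
      = ?m * (\<Sum>g\<in>sym_grp n. ?e (inv g \<circ> inv w \<circ> g))"
  proof -
    have "(\<Sum>g\<in>sym_grp n. ?f (inv g \<circ> w \<circ> g)) = (\<Sum>g\<in>sym_grp n. ?f (inv g \<circ> inv w \<circ> g))"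
    proof (rule sum.cong[OF refl])
      fix g assume g: "g \<in> sym_grp n"
      show "?f (inv g \<circ> w \<circ> g) = ?f (inv g \<circ> inv w \<circ> g)"
        by (rule F.f_eqI) (use g w in \<open>simp_all add: comp_assoc sym_grp_inv_comp[of _ n]\<close>)
    qed
    also have "\<dots> = (\<Sum>g\<in>sym_grp n. \<Sum>p\<in>row_group n \<nu>. ?e (inv g \<circ> inv w \<circ> g \<circ> inv p))"
      using w by (intro sum.cong refl) (simp add: young_sym_def ga_mult_eq_right sum_row_sum)
    also have "\<dots> = (\<Sum>p\<in>row_group n \<nu>. \<Sum>g\<in>sym_grp n. ?e (inv g \<circ> inv w \<circ> g \<circ> inv p))"
      by (rule sum.swap)
    also have "\<dots> = (\<Sum>p\<in>row_group n \<nu>. \<Sum>g\<in>sym_grp n. ?e (inv g \<circ> inv w \<circ> g))"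
    proof (rule sum.cong[OF refl])
      fix p assume p: "p \<in> row_group n \<nu>"
      then have pG: "p \<in> sym_grp n" and ip: "inv p \<in> row_group n \<nu>"
        by (auto simp: row_group_eq sym_stab_inv sym_stab_sym_grp)
      \<comment> \<open>Replacing \<open>g\<close> by \<open>g \<circ> p\<close> turns the trailing
        \<open>inv p\<close> into a leading one, which row invariance absorbs.\<close>
      have "?e (inv (g \<circ> p) \<circ> inv w \<circ> (g \<circ> p) \<circ> inv p) = ?e (inv g \<circ> inv w \<circ> g)"
        if "g \<in> sym_grp n" for g
        using young_left[OF ip, of "inv g \<circ> inv w \<circ> g"] that w pG by (simp add: comp_assoc)
      then show "(\<Sum>g\<in>sym_grp n. ?e (inv g \<circ> inv w \<circ> g \<circ> inv p))
          = (\<Sum>g\<in>sym_grp n. ?e (inv g \<circ> inv w \<circ> g))"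
        using sum_sym_grp_right[OF pG, of "\<lambda>g. ?e (inv g \<circ> inv w \<circ> g \<circ> inv p)"] by simp
    qed
    finally show ?thesis by simp
  qed
  ultimately show ?thesis using m unfolding F.chi_def by (simp add: \<kappa>)
qed

lemma irr_char_class:
  assumes "is_partition n \<nu>" "w \<in> sym_grp n" "h \<in> sym_grp n"
  shows "irr_char n \<nu> (inv h \<circ> w \<circ> h) = irr_char n \<nu> w"
  using spherical.chi_conj[OF spherical_young[OF assms(1)] assms(3,2)] assms
  by (simp add: irr_char_eq_chi)

lemma irr_char_indicator:
  assumes "is_partition n \<nu>"
  shows "(\<Sum>v\<in>sym_grp n. irr_char n \<nu> (v \<circ> v)) = fact n"
  using spherical.chi_indicator[OF spherical_young[OF assms]] assms
  by (simp add: irr_char_eq_chi)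

lemma irr_char_orthonormal:
  assumes "is_partition n \<nu>" "is_partition n \<nu>'"
  shows "(\<Sum>w\<in>sym_grp n. irr_char n \<nu> w * irr_char n \<nu>' w) = (if \<nu> = \<nu>' then fact n else 0)"
proof -
  have lt: "(\<Sum>w\<in>sym_grp n. irr_char n \<alpha> w * irr_char n \<beta> w) = 0"
    if "is_partition n \<alpha>" "is_partition n \<beta>" "sum_list (take r \<beta>) < sum_list (take r \<alpha>)" for \<alpha> \<beta> r
    using spherical_orthogonal[OF spherical_young[OF that(1)] spherical_young[OF that(2)]
        young_sym_orthogonal[OF that]] that
    by (simp add: irr_char_eq_chi)
  \<comment> \<open>Distinct partitions differ in some partial sum; the sign of the difference
    decides in which order \<open>lt\<close> applies to them.\<close>
  have "\<nu> = \<nu>' \<or> (\<exists>r. sum_list (take r \<nu>') < sum_list (take r \<nu>))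
      \<or> (\<exists>r. sum_list (take r \<nu>) < sum_list (take r \<nu>'))"
    using sum_list_take_inject[of \<nu> \<nu>'] assms by (meson is_partition_def nat_neq_iff)
  then consider "\<nu> = \<nu>'" | r where "sum_list (take r \<nu>') < sum_list (take r \<nu>)"
    | r where "sum_list (take r \<nu>) < sum_list (take r \<nu>')"
    by blast
  then show ?thesis
  proof cases
    case 1
    then show ?thesis using spherical.chi_norm[OF spherical_young[OF assms(1)]] assms
      by (simp add: irr_char_eq_chi)
  next
    case (2 r)
    then show ?thesis using lt[OF assms] by auto
  next
    case (3 r)
    then show ?thesis using lt[OF assms(2,1)] by (auto simp: mult.commute)
  qed
qed

section \<open>Square roots of permutations\<close>

lemma funpow_eq_iff_orbit:
  assumes "permutation f"
  shows "(f ^^ i) x = (f ^^ j) x \<longleftrightarrow> i mod card (orbit f x) = j mod card (orbit f x)"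
proof -
  \<comment> \<open>The first return time of \<open>x\<close>, which equals the size of its
    orbit.\<close>
  define d where "d = funpow_dist1 f x x"
  have self: "x \<in> orbit f x" using assms by (rule permutation_self_in_orbit)
  have orb: "orbit f x = (\<lambda>n. (f ^^ n) x) ` {0..<d}"
    unfolding d_def by (rule orbit_conv_funpow_dist1[OF self])
  have inj: "inj_on (\<lambda>n. (f ^^ n) x) {0..<d}"
    unfolding d_def by (rule inj_on_funpow_dist1[OF self])
  have card: "card (orbit f x) = d" using orb card_image[OF inj] by simp
  have per: "(f ^^ d) x = x" unfolding d_def by (rule funpow_dist1_prop[OF self])
  have d: "d > 0" by (simp add: d_def)
  have "(f ^^ i) x = (f ^^ (i mod d)) x" for i using per by (simp add: funpow_mod_eq)
  then have "(f ^^ i) x = (f ^^ j) x \<longleftrightarrow> (f ^^ (i mod d)) x = (f ^^ (j mod d)) x" by metis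
  also have "\<dots> \<longleftrightarrow> i mod d = j mod d"
    using inj_on_eq_iff[OF inj, of "i mod d" "j mod d"] d by simp
  finally show ?thesis by (simp add: card)
qed

text \<open>Sending the i-th iterate of \<open>x\<close> to the i-th iterate of \<open>y\<close> is
  well defined and injective because both orbits have the same period.\<close>

lemma orbit_equivariant_bij:
  assumes f: "permutation f" and g: "permutation g" and card: "card (orbit f x) = card (orbit g y)"
  shows "\<exists>h. bij_betw h (orbit f x) (orbit g y) \<and> h x = y \<and> (\<forall>z\<in>orbit f x. h (f z) = g (h z))"
proof -
  define h where "h = (\<lambda>z. (g ^^ funpow_dist f x z) y)"
  have orb: "orbit f x = range (\<lambda>i. (f ^^ i) x)" "orbit g y = range (\<lambda>i. (g ^^ i) y)"
    using orbit_altdef_permutation[OF f, of x] orbit_altdef_permutation[OF g, of y] by auto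
  have h: "h ((f ^^ i) x) = (g ^^ i) y" for i
  proof -
    have "(f ^^ i) x \<in> orbit f x" by (simp add: orb)
    then have "(f ^^ funpow_dist f x ((f ^^ i) x)) x = (f ^^ i) x" by (rule funpow_dist_prop)
    then show ?thesis
      unfolding h_def by (simp add: funpow_eq_iff_orbit[OF f] funpow_eq_iff_orbit[OF g] card)
  qed
  have "bij_betw h (orbit f x) (orbit g y)"
  proof (rule bij_betw_imageI)
    show "inj_on h (orbit f x)"
    proof (rule inj_onI)
      fix a b assume "a \<in> orbit f x" "b \<in> orbit f x" and eq: "h a = h b"
      then obtain i j where ab: "a = (f ^^ i) x" "b = (f ^^ j) x" by (auto simp: orb)
      then show "a = b"
        using eq by (simp add: h funpow_eq_iff_orbit[OF f] funpow_eq_iff_orbit[OF g] card)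
    qed
    show "h ` orbit f x = orbit g y" by (simp add: orb image_image h)
  qed
  moreover have "h (f z) = g (h z)" if z: "z \<in> orbit f x" for z
  proof -
    obtain i where i: "z = (f ^^ i) x" using z by (auto simp: orb)
    show ?thesis using h[of "Suc i"] h[of i] by (simp add: i)
  qed
  moreover have "h x = y" using h[of 0] by simp
  ultimately show ?thesis by blast
qed

text \<open>The cycle type over an arbitrary set: the induction that counts square roots removes
  cycles and leaves subsets of \<open>{..<n}\<close>.\<close>

definition orbits_type :: "'a set \<Rightarrow> ('a \<Rightarrow> 'a) \<Rightarrow> nat multiset" where
  "orbits_type A w = image_mset card (mset_set (orbit w ` A))"

lemma cycle_type_eq: "cycle_type n w = orbits_type {..<n} w"
  by (simp add: cycle_type_def orbits_type_def)

lemma permutes_finite_permutation: "w permutes A \<Longrightarrow> finite A \<Longrightarrow> permutation w"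
  by (auto simp: permutation_permutes)

lemma orbit_eq_iff_mem:
  assumes "permutation f"
  shows "orbit f x = orbit f y \<longleftrightarrow> x \<in> orbit f y"
  using assms by (metis cyclic_on_orbit' orbit_cyclic_eq3 permutation_self_in_orbit)

text \<open>Any bijection matches the values up to rearrangement; composing with a permutation of
  \<open>X\<close> repairs it.\<close>

lemma image_mset_eq_imp_bij:
  assumes "finite X" "finite Y" "image_mset c (mset_set X) = image_mset d (mset_set Y)"
  shows "\<exists>b. bij_betw b X Y \<and> (\<forall>x\<in>X. d (b x) = c x)"
proof -
  have "card X = card Y" using arg_cong[OF assms(3), of size] assms(1,2) by simp
  then obtain b where b: "bij_betw b X Y" using assms finite_same_card_bij by blast
  have "image_mset b (mset_set X) = mset_set Y"
    using b image_mset_mset_set[of b X] by (simp add: bij_betw_def)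
  then have "image_mset c (mset_set X) = image_mset (d \<circ> b) (mset_set X)"
    using assms(3) by (simp flip: multiset.map_comp)
  then obtain p where p: "p permutes X" "\<forall>x\<in>X. c x = (d \<circ> b) (p x)"
    using image_mset_eq_implies_permutes[OF assms(1)] by blast
  have "bij_betw (b \<circ> p) X Y" using bij_betw_trans[OF permutes_imp_bij[OF p(1)] b] .
  then show ?thesis using p(2) by (intro exI[of _ "b \<circ> p"]) simp
qed

text \<open>Orbits of equal size are matched, and the equivariant bijections between matched orbits
  are glued, each point using the one chosen for its own orbit.\<close>

lemma orbits_type_eq_imp_equivariant:
  assumes A: "finite A" "f permutes A" and B: "finite B" "g permutes B"
    and eq: "orbits_type A f = orbits_type B g"
  shows "\<exists>h. bij_betw h A B \<and> (\<forall>x\<in>A. h (f x) = g (h x))"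
proof -
  have f: "permutation f" and g: "permutation g"
    using permutes_finite_permutation A B by auto
  obtain b where b: "bij_betw b (orbit f ` A) (orbit g ` B)"
    "\<And>Q. Q \<in> orbit f ` A \<Longrightarrow> card (b Q) = card Q"
    using image_mset_eq_imp_bij[of "orbit f ` A" "orbit g ` B" card card] A B eq
    unfolding orbits_type_def by blast
  have "\<exists>h. bij_betw h Q (b Q) \<and> (\<forall>z\<in>Q. h (f z) = g (h z))" if Q: "Q \<in> orbit f ` A" for Q
  proof -
    obtain x where x: "Q = orbit f x" using Q by auto
    obtain y where y: "b Q = orbit g y" using bij_betw_apply[OF b(1) Q] by auto
    show ?thesis
      using orbit_equivariant_bij[OF f g, of x y] b(2)[OF Q] unfolding y unfolding x by auto
  qed
  then have "\<exists>H. \<forall>Q\<in>orbit f ` A. bij_betw (H Q) Q (b Q) \<and> (\<forall>z\<in>Q. H Q (f z) = g (H Q z))"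
    by (intro bchoice) blast
  then obtain H where H: "\<And>Q. Q \<in> orbit f ` A \<Longrightarrow> bij_betw (H Q) Q (b Q)"
    "\<And>Q z. Q \<in> orbit f ` A \<Longrightarrow> z \<in> Q \<Longrightarrow> H Q (f z) = g (H Q z)"
    by blast
  define h where "h = (\<lambda>x. H (orbit f x) x)"
  have self: "x \<in> orbit f x" for x by (rule permutation_self_in_orbit[OF f])
  have hb: "h x \<in> b (orbit f x)" if "x \<in> A" for x
    using bij_betw_apply[OF H(1)] that self by (simp add: h_def)
  have bB: "b (orbit f x) \<in> orbit g ` B" if "x \<in> A" for x
    using b(1) that by (auto simp: bij_betw_def)
  have hB: "orbit g (h x) = b (orbit f x)" if "x \<in> A" for x
  proof -
    obtain y where "b (orbit f x) = orbit g y" using bB[OF \<open>x \<in> A\<close>] by blast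
    then show ?thesis using hb[OF \<open>x \<in> A\<close>] orbit_eq_iff_mem[OF g, of "h x" y] by simp
  qed
  have "bij_betw h A B"
  proof (rule bij_betw_imageI)
    show "inj_on h A"
    proof (rule inj_onI)
      fix x y assume xy: "x \<in> A" "y \<in> A" "h x = h y"
      then have "b (orbit f x) = b (orbit f y)" using hB[of x] hB[of y] by simp
      then have o: "orbit f x = orbit f y"
        using b(1) xy by (auto simp: bij_betw_def dest: inj_onD)
      then have "H (orbit f x) x = H (orbit f x) y" using xy by (simp add: h_def)
      then show "x = y"
        using inj_onD[OF bij_betw_imp_inj_on[OF H(1)], of "orbit f x" x y] xy self[of x] self[of y] o
        by auto
    qed
    show "h ` A = B"
    proof
      show "h ` A \<subseteq> B"
      proof
        fix y assume "y \<in> h ` A"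
        then obtain x where "x \<in> A" "y = h x" by auto
        then show "y \<in> B" using hb[of x] bB[of x] permutes_orbit_subset[OF B(2)] by auto
      qed
      show "B \<subseteq> h ` A"
      proof
        fix y assume y: "y \<in> B"
        then obtain Q where Q: "Q \<in> orbit f ` A" "orbit g y = b Q"
          using b(1) by (metis bij_betw_def imageE imageI)
        then obtain x where x: "x \<in> Q" "H Q x = y"
          using H(1)[OF Q(1)] permutation_self_in_orbit[OF g, of y] by (metis bij_betw_def imageE)
        obtain x' where x': "x' \<in> A" "Q = orbit f x'" using Q(1) by blast
        have "orbit f x = Q" using x(1) x'(2) orbit_eq_iff_mem[OF f, of x x'] by simp
        moreover have "x \<in> A" using x(1) x' permutes_orbit_subset[OF A(2)] by blast
        ultimately show "y \<in> h ` A" using x by (auto simp: h_def)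
      qed
    qed
  qed
  moreover have "h (f x) = g (h x)" if "x \<in> A" for x
    using H(2)[of "orbit f x" x] that self
    by (simp add: h_def permutation_orbit_step[OF f])
  ultimately show ?thesis by blast
qed

lemma orbits_type_eq_imp_conj:
  assumes A: "finite A" "f permutes A" "g permutes A" and eq: "orbits_type A f = orbits_type A g"
  shows "\<exists>p. p permutes A \<and> g = p \<circ> f \<circ> inv p"
proof -
  obtain h where h: "bij_betw h A A" "\<And>x. x \<in> A \<Longrightarrow> h (f x) = g (h x)"
    using orbits_type_eq_imp_equivariant[OF A(1,2) A(1,3) eq] by blast
  define p where "p = (\<lambda>x. if x \<in> A then h x else x)"
  have p: "p permutes A"
    by (rule bij_imp_permutes) (use h(1) in \<open>auto simp: p_def cong: bij_betw_cong\<close>)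
  have "p \<circ> f = g \<circ> p"
  proof
    fix x
    show "(p \<circ> f) x = (g \<circ> p) x"
      using h(2) A permutes_in_image[OF A(2)] permutes_not_in[OF A(2)] permutes_not_in[OF A(3)]
      by (simp add: p_def)
  qed
  then have "p \<circ> f \<circ> inv p = g" using permutes_inv_o(1)[OF p] by (simp add: comp_assoc)
  then show ?thesis using p by auto
qed

lemma conj_orbit:
  assumes "permutation f" "bij p"
  shows "orbit (p \<circ> f \<circ> inv p) (p x) = p ` orbit f x"
  by (rule orbit_inverse[symmetric])
     (use assms in \<open>auto simp: permutation_self_in_orbit bij_is_inj\<close>)

lemma orbits_type_conj:
  assumes "finite A" "f permutes A" "p permutes A"
  shows "orbits_type A (p \<circ> f \<circ> inv p) = orbits_type A f"
proof -
  have p: "bij p" using permutes_bij assms by blast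
  have inj: "inj_on ((`) p) X" for X
    using p by (auto simp: inj_on_def bij_def inj_image_eq_iff)
  have "orbit (p \<circ> f \<circ> inv p) ` A = orbit (p \<circ> f \<circ> inv p) ` p ` A"
    using permutes_image[OF assms(3)] by simp
  also have "\<dots> = (`) p ` orbit f ` A"
    using conj_orbit[OF permutes_finite_permutation[OF assms(2,1)] p] by (simp add: image_image)
  finally have "orbits_type A (p \<circ> f \<circ> inv p) = image_mset card (image_mset ((`) p) (mset_set (orbit f ` A)))"
    by (simp add: orbits_type_def image_mset_mset_set[OF inj])
  then show ?thesis
    using p by (simp add: orbits_type_def multiset.map_comp card_image comp_def bij_is_inj inj_on_subset[of p UNIV])
qed

section \<open>Recursion for the factors\<close>

lemma odd_dfact_Suc: "odd_dfact (Suc k) = (2 * k + 1) * odd_dfact k"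
  by (simp add: odd_dfact_def)

lemma odd_dfact_0: "odd_dfact 0 = 1"
  by (simp add: odd_dfact_def)

lemma c_factor_0 [simp]: "c_factor i 0 = 1"
  by (simp add: c_factor_def odd_dfact_0)

text \<open>The flexible upper limit \<open>L\<close> lets sums for different \<open>m\<close> be
  compared term by term; the added binomials are zero.\<close>

lemma c_factor_odd:
  assumes "odd i" "m div 2 \<le> L"
  shows "c_factor i m = (\<Sum>k\<le>L. (m choose (2 * k)) * odd_dfact k * i ^ k)"
proof -
  have "c_factor i m = (\<Sum>k\<in>{0..m div 2}. (m choose (2 * k)) * odd_dfact k * i ^ k)"
    using assms(1) unfolding c_factor_def
    by (auto intro!: sum.cong simp: binomial_symmetric[of "2 * _" m])
  also have "\<dots> = (\<Sum>k\<le>L. (m choose (2 * k)) * odd_dfact k * i ^ k)"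
    by (rule sum.mono_neutral_left) (use assms(2) in auto)
  finally show ?thesis .
qed

text \<open>Mirrors the choice for one cycle among \<open>Suc m\<close> of length \<open>i\<close>:
  it is fixed, for odd \<open>i\<close> only, or swapped with one of the \<open>m\<close> others in
  \<open>i\<close> ways. The truncated \<open>m - 1\<close> at \<open>m = 0\<close> is harmless, as
  its factor is zero.\<close>

lemma c_factor_rec:
  "c_factor i (Suc m) = (if odd i then c_factor i m else 0) + m * i * c_factor i (m - 1)"
proof (cases "odd i")
  case False
  then show ?thesis
    by (cases m) (auto simp: c_factor_def odd_dfact_Suc algebra_simps elim!: evenE oddE)
next
  case True
  show ?thesis
  proof (cases m)
    case 0
    then show ?thesis using True by (simp add: c_factor_def odd_dfact_0)
  next
    case (Suc m')
    let ?t = "\<lambda>m k. (m choose (2 * k)) * odd_dfact k * i ^ k"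
    \<comment> \<open>Pascal's rule splits the binomial; absorption turns the second part times
      \<open>2 * k + 1\<close>, the new factor of the double factorial, into \<open>Suc m'\<close>
      times a binomial of \<open>m'\<close>.\<close>
    have rec: "?t (Suc (Suc m')) (Suc k) = ?t (Suc m') (Suc k) + Suc m' * i * ?t m' k" for k
    proof -
      have "(Suc m' choose (2 * k + 1)) * (2 * k + 1) = Suc m' * (m' choose (2 * k))"
        using Suc_times_binomial[of "2 * k" m'] by (simp add: mult.commute)
      then have *: "(Suc m' choose (2 * k + 1)) * (2 * k + 1) * (odd_dfact k * i ^ Suc k)
          = Suc m' * (m' choose (2 * k)) * (odd_dfact k * i ^ Suc k)" by (rule arg_cong)
      have "(Suc (Suc m') choose (2 * Suc k)) = (Suc m' choose (2 * Suc k)) + (Suc m' choose (2 * k + 1))"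
        by simp
      then have "?t (Suc (Suc m')) (Suc k)
          = ?t (Suc m') (Suc k) + (Suc m' choose (2 * k + 1)) * (2 * k + 1) * (odd_dfact k * i ^ Suc k)"
        unfolding odd_dfact_Suc by (simp only: algebra_simps)
      then show ?thesis unfolding * by (simp only: power_Suc mult_ac)
    qed
    have "c_factor i (Suc (Suc m')) = (\<Sum>k\<le>Suc (Suc m'). ?t (Suc (Suc m')) k)"
      by (rule c_factor_odd[OF True]) simp
    also have "\<dots> = 1 + (\<Sum>k\<le>Suc m'. ?t (Suc m') (Suc k)) + (\<Sum>k\<le>Suc m'. Suc m' * i * ?t m' k)"
      by (subst sum.atMost_Suc_shift) (simp only: rec sum.distrib, simp add: odd_dfact_0)
    also have "1 + (\<Sum>k\<le>Suc m'. ?t (Suc m') (Suc k)) = (\<Sum>k\<le>Suc (Suc m'). ?t (Suc m') k)"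
      by (subst sum.atMost_Suc_shift) (simp add: odd_dfact_0)
    also have "\<dots> = c_factor i (Suc m')"
      by (rule c_factor_odd[OF True, symmetric]) simp
    also have "(\<Sum>k\<le>Suc m'. Suc m' * i * ?t m' k) = Suc m' * i * c_factor i m'"
      by (simp add: c_factor_odd[OF True, of m' "Suc m'"] sum_distrib_left mult.assoc del: sum.atMost_Suc)
    finally show ?thesis using True Suc by simp
  qed
qed

section \<open>Counting square roots cycle by cycle\<close>

definition sqrts :: "'a set \<Rightarrow> ('a \<Rightarrow> 'a) \<Rightarrow> ('a \<Rightarrow> 'a) set" where
  "sqrts A w = {v. v permutes A \<and> v \<circ> v = w}"

lemma finite_sqrts: "finite A \<Longrightarrow> finite (sqrts A w)"
  by (rule finite_subset[OF _ finite_permutations[of A]]) (auto simp: sqrts_def)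

text \<open>Roots prescribed as \<open>u\<close> on \<open>Q\<close> restrict to roots on the
  complement. Conversely a root on the complement is the identity on \<open>Q\<close> and glues with
  \<open>u\<close> by composition.\<close>

lemma card_sqrts_extending:
  assumes A: "finite A" "w permutes A" and Q: "Q \<subseteq> A"
    and u: "u permutes Q" "\<And>z. z \<in> Q \<Longrightarrow> u (u z) = w z"
  shows "card {v \<in> sqrts A w. \<forall>z\<in>Q. v z = u z} = card (sqrts (A - Q) (perm_restrict w (A - Q)))"
proof -
  let ?S = "{v \<in> sqrts A w. \<forall>z\<in>Q. v z = u z}" and ?T = "sqrts (A - Q) (perm_restrict w (A - Q))"
  let ?F = "\<lambda>v. perm_restrict v (A - Q)" and ?G = "\<lambda>v'. v' \<circ> u"
  note uQ = permutes_in_image[OF u(1)] and u_out = permutes_not_in[OF u(1)]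
  have "bij_betw ?F ?S ?T"
  proof (rule bij_betw_byWitness[where f' = ?G])
    show "\<forall>v\<in>?S. ?G (?F v) = v"
    proof (intro ballI ext)
      fix v z assume "v \<in> ?S"
      then have v: "v permutes A" "\<And>z. z \<in> Q \<Longrightarrow> v z = u z" by (simp_all add: sqrts_def)
      show "?G (?F v) z = v z"
      proof (cases "z \<in> Q")
        case True
        then show ?thesis using uQ[of z] v(2) by (simp add: perm_restrict_def)
      next
        case False
        then show ?thesis using u_out[of z] permutes_not_in[OF v(1), of z]
          by (simp add: perm_restrict_def)
      qed
    qed
    show "\<forall>v'\<in>?T. ?F (?G v') = v'"
    proof (intro ballI ext)
      fix v z assume "v \<in> ?T"
      then have v: "v permutes (A - Q)" by (simp add: sqrts_def)
      show "?F (?G v) z = v z"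
        using u_out[of z] permutes_not_in[OF v, of z] by (auto simp: perm_restrict_def)
    qed
    show "?F ` ?S \<subseteq> ?T"
    proof safe
      fix v assume v: "v \<in> sqrts A w" "\<forall>z\<in>Q. v z = u z"
      then have vA: "v permutes A" and vv: "\<And>z. v (v z) = w z" by (auto simp: sqrts_def fun_eq_iff)
      have inQ: "v z \<in> A - Q" if z: "z \<in> A - Q" for z
      proof -
        have "v z \<notin> Q"
        proof
          assume "v z \<in> Q"
          then obtain t where "t \<in> Q" "u t = v z" using permutes_image[OF u(1)] by (metis imageE)
          then have "v t = v z" using v(2) by simp
          then show False using permutes_inj[OF vA] \<open>t \<in> Q\<close> z by (auto dest: injD)
        qed
        then show ?thesis using permutes_in_image[OF vA] z by simp
      qed
      have "?F v permutes (A - Q)"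
        by (rule inj_imp_permutes)
           (use A inQ permutes_inj[OF vA] in \<open>auto simp: perm_restrict_def inj_on_def dest: injD\<close>)
      moreover have "?F v \<circ> ?F v = perm_restrict w (A - Q)"
        using inQ vv by (auto simp: perm_restrict_def fun_eq_iff)
      ultimately show "?F v \<in> ?T" by (simp add: sqrts_def)
    qed
    show "?G ` ?T \<subseteq> ?S"
    proof safe
      fix v assume "v \<in> ?T"
      then have v: "v permutes (A - Q)" and vv: "\<And>z. v (v z) = perm_restrict w (A - Q) z"
        by (auto simp: sqrts_def fun_eq_iff)
      have "v \<circ> u permutes A"
        using permutes_subset[OF v] permutes_subset[OF u(1) Q] by (intro permutes_compose) auto
      moreover have "(?G v \<circ> ?G v) z = w z" for z
      proof (cases "z \<in> Q")
        case True
        then have "v t = t" if "t \<in> Q" for t using permutes_not_in[OF v] that by simp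
        moreover have "u z \<in> Q" "w z \<in> Q" using True uQ u(2)[OF True] by metis+
        ultimately show ?thesis using u(2)[OF True] by simp
      next
        case False
        then have "v z \<notin> Q" using permutes_in_image[OF v, of z] permutes_not_in[OF v, of z]
          by (cases "z \<in> A - Q") auto
        then show ?thesis
          using False u_out vv[of z] permutes_not_in[OF A(2), of z] by (auto simp: perm_restrict_def)
      qed
      ultimately show "?G v \<in> sqrts A w" by (auto simp: sqrts_def)
      fix z assume "z \<in> Q"
      then show "?G v z = u z" using uQ permutes_not_in[OF v] by simp
    qed
  qed
  then show ?thesis by (rule bij_betw_same_card)
qed

lemma orbit_image_perm_restrict:
  assumes "w permutes A" "\<And>z. w z \<in> Q \<longleftrightarrow> z \<in> Q"
  shows "orbit (perm_restrict w (A - Q)) ` (A - Q) = orbit w ` (A - Q)"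
proof (rule image_cong[OF refl])
  fix z assume z: "z \<in> A - Q"
  show "orbit (perm_restrict w (A - Q)) z = orbit w z"
    by (rule orbit_cong0[symmetric, OF z])
       (use assms permutes_in_image[OF assms(1)] in \<open>auto simp: perm_restrict_def\<close>)
qed

lemma perm_restrict_permutes:
  assumes "finite A" "w permutes A" "\<And>z. w z \<in> Q \<longleftrightarrow> z \<in> Q"
  shows "perm_restrict w (A - Q) permutes (A - Q)"
  by (rule inj_imp_permutes)
     (use assms permutes_in_image[OF assms(2)] permutes_inj[OF assms(2)]
      in \<open>auto simp: perm_restrict_def inj_on_def dest: injD\<close>)

lemma orbit_step_mem_iff:
  assumes "permutation w"
  shows "w z \<in> orbit w x \<longleftrightarrow> z \<in> orbit w x"
  using orbit_eq_iff_mem[OF assms, of "w z" x] orbit_eq_iff_mem[OF assms, of z x]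
  by (simp add: permutation_orbit_step[OF assms])

text \<open>\<open>Q\<close> stands for the cycles already removed, so that the lemma can be
  iterated: first with \<open>Q\<close> empty, then with one cycle.\<close>

lemma orbits_type_remove:
  assumes A: "finite A" "w permutes A" and x: "x \<in> A" and Q: "\<And>z. w z \<in> Q \<longleftrightarrow> z \<in> Q" "x \<notin> Q"
  shows "orbits_type (A - Q) (perm_restrict w (A - Q))
    = add_mset (card (orbit w x))
        (orbits_type (A - (Q \<union> orbit w x)) (perm_restrict w (A - (Q \<union> orbit w x))))"
proof -
  have w: "permutation w" using permutes_finite_permutation A by auto
  have xQ: "orbit w x \<inter> Q = {}"
  proof -
    have "z \<notin> Q" if "z \<in> orbit w x" for z using that by induct (use Q in auto)
    then show ?thesis by auto
  qed
  have Q': "w z \<in> Q \<union> orbit w x \<longleftrightarrow> z \<in> Q \<union> orbit w x" for z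
    using Q(1) orbit_step_mem_iff[OF w] by auto
  have "orbit w ` (A - Q) = insert (orbit w x) (orbit w ` (A - (Q \<union> orbit w x)))"
    using x Q(2) xQ orbit_eq_iff_mem[OF w] by (auto simp: image_iff)
  moreover have "orbit w x \<notin> orbit w ` (A - (Q \<union> orbit w x))"
    using orbit_eq_iff_mem[OF w] permutation_self_in_orbit[OF w] by blast
  ultimately show ?thesis
    unfolding orbits_type_def orbit_image_perm_restrict[OF A(2) Q(1)]
      orbit_image_perm_restrict[OF A(2) Q'] using A(1) by simp
qed

text \<open>A square root commutes with its square, so on each cycle of \<open>w\<close> it is
  determined by the image of one point.\<close>

lemma sqrts_funpow:
  assumes "v \<in> sqrts A w"
  shows "v ((w ^^ i) x) = (w ^^ i) (v x)"
proof (induction i)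
  case (Suc i)
  have "v (w z) = w (v z)" for z using assms by (auto simp: sqrts_def)
  then show ?case using Suc by simp
qed simp

text \<open>A square root \<open>v\<close> of \<open>w\<close> maps the orbit of \<open>x\<close> either to itself, acting there as a power of
  \<open>w\<close>, or it interchanges this orbit with another one of the same length.\<close>

lemma card_sqrts_same_orbit:
  assumes A: "finite A" "w permutes A" and x: "x \<in> A"
  defines "Q \<equiv> orbit w x"
  shows "(\<Sum>y\<in>Q. card {v \<in> sqrts A w. v x = y})
    = (if odd (card Q) then card (sqrts (A - Q) (perm_restrict w (A - Q))) else 0)"
proof -
  let ?k = "card Q"
  have w: "permutation w" using permutes_finite_permutation A by auto
  have QA: "Q \<subseteq> A" unfolding Q_def using permutes_orbit_subset A x by metis
  have finQ: "finite Q" using QA A finite_subset by blast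
  \<comment> \<open>The inverse of 2 modulo the cycle length when that length is odd:
    \<open>2 * e\<close> is then \<open>?k + 1\<close>.\<close>
  define e where "e = (?k + 1) div 2"
  note per = funpow_eq_iff_orbit[OF w, where x = x, folded Q_def]
  have orb: "Q = range (\<lambda>i. (w ^^ i) x)"
    using orbit_altdef_permutation[OF w, of x] unfolding Q_def by auto
  \<comment> \<open>If \<open>v x\<close> is the \<open>j\<close>-th iterate of \<open>x\<close>,
    then \<open>v (v x) = w x\<close> makes \<open>2 * j\<close> congruent to 1 modulo
    \<open>?k\<close>. So \<open>?k\<close> is odd and \<open>j\<close> is congruent to
    \<open>e\<close>.\<close>
  have only: "odd ?k \<and> y = (w ^^ e) x" if v: "v \<in> sqrts A w" "v x = y" and y: "y \<in> Q" for v y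
  proof -
    obtain j where j: "y = (w ^^ j) x" using y by (auto simp: orb)
    have "(w ^^ 1) x = v (v x)" using v(1) by (auto simp: sqrts_def)
    also have "\<dots> = v ((w ^^ j) x)" using v(2) j by simp
    also have "\<dots> = (w ^^ j) ((w ^^ j) x)" using sqrts_funpow[OF v(1)] v(2) j by simp
    also have "\<dots> = (w ^^ (2 * j)) x" by (simp add: mult_2 funpow_add)
    finally have 1: "2 * j mod ?k = 1 mod ?k" using per[of 1 "2 * j"] by simp
    have "odd ?k"
    proof
      assume "even ?k"
      then have "(2 * j mod ?k) mod 2 = (1 mod ?k) mod 2" using 1 by simp
      then show False using \<open>even ?k\<close> by (simp add: mod_mod_cancel)
    qed
    moreover have "j mod ?k = e mod ?k"
    proof -
      have e: "2 * e = ?k + 1" using \<open>odd ?k\<close> by (simp add: e_def)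
      have "e mod ?k = e * (2 * j) mod ?k" using 1 by (metis mod_mult_right_eq mult.right_neutral)
      also have "e * (2 * j) = j + j * ?k" using arg_cong[OF e, of "\<lambda>t. t * j"] by (simp add: algebra_simps)
      also have "\<dots> mod ?k = j mod ?k" by simp
      finally show ?thesis by simp
    qed
    ultimately show ?thesis using j per[of j e] by simp
  qed
  show ?thesis
  proof (cases "odd ?k")
    case False
    then have "{v \<in> sqrts A w. v x = y} = {}" if "y \<in> Q" for y using only that by auto
    then have "(\<Sum>y\<in>Q. card {v \<in> sqrts A w. v x = y}) = (\<Sum>y\<in>Q. 0)"
      by (intro sum.cong refl) (simp only: card.empty)
    then show ?thesis using False by simp
  next
    case True
    let ?y = "(w ^^ e) x"
    define u where "u = perm_restrict (w ^^ e) Q"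
    have yQ: "?y \<in> Q" by (auto simp: orb)
    have pow: "(w ^^ i) z \<in> Q" if "z \<in> Q" for z i
      using that unfolding Q_def by (rule funpow_in_orbit)
    have "inj (w ^^ e)" using permutes_inj[OF A(2)] by (induction e) (auto intro: inj_compose)
    then have u: "u permutes Q" unfolding u_def
      by (intro inj_imp_permutes finQ) (auto simp: perm_restrict_def inj_on_def pow dest: injD)
    have uu: "u (u z) = w z" if z: "z \<in> Q" for z
    proof -
      obtain i where i: "z = (w ^^ i) x" using z by (auto simp: orb)
      have e: "e + (e + i) = ?k + Suc i" using True by (simp add: e_def) presburger
      have "u (u z) = (w ^^ (e + (e + i))) x"
        using z pow by (simp add: u_def perm_restrict_def i funpow_add)
      also have "\<dots> = (w ^^ Suc i) x" unfolding e per by (simp only: mod_add_self1)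
      finally show ?thesis by (simp add: i)
    qed
    have "(\<Sum>y\<in>Q. card {v \<in> sqrts A w. v x = y}) = (\<Sum>y\<in>{?y}. card {v \<in> sqrts A w. v x = y})"
    proof (rule sum.mono_neutral_right[OF finQ])
      show "\<forall>y\<in>Q - {?y}. card {v \<in> sqrts A w. v x = y} = 0"
      proof
        fix y assume y: "y \<in> Q - {?y}"
        then have "{v \<in> sqrts A w. v x = y} = {}" using only by auto
        then show "card {v \<in> sqrts A w. v x = y} = 0" by (simp only: card.empty)
      qed
    qed (use yQ in simp)
    also have "\<dots> = card {v \<in> sqrts A w. v x = ?y}" by simp
    also have "{v \<in> sqrts A w. v x = ?y} = {v \<in> sqrts A w. \<forall>z\<in>Q. v z = u z}"
    proof (intro Collect_cong conj_cong refl iffI ballI)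
      fix v z assume v: "v \<in> sqrts A w" "v x = ?y" and z: "z \<in> Q"
      obtain i where i: "z = (w ^^ i) x" using z by (auto simp: orb)
      have "v z = (w ^^ (i + e)) x" using sqrts_funpow[OF v(1), of i x] v(2) by (simp add: i funpow_add)
      also have "\<dots> = u z" using z by (simp add: u_def perm_restrict_def i funpow_add add.commute[of i])
      finally show "v z = u z" .
    next
      fix v assume "\<forall>z\<in>Q. v z = u z"
      moreover have "x \<in> Q" unfolding Q_def by (rule permutation_self_in_orbit[OF w])
      ultimately show "v x = ?y" by (simp add: u_def perm_restrict_def)
    qed
    also have "card \<dots> = card (sqrts (A - Q) (perm_restrict w (A - Q)))"
      by (rule card_sqrts_extending[OF A QA u uu])
    finally show ?thesis using True by simp
  qed
qed

text \<open>The image of \<open>x\<close> determines the equivariant bijection from its cycle to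
  that of \<open>y\<close>, and v v = w then determines the way back; such a bijection exists
  exactly for equal lengths.\<close>

lemma card_sqrts_other_orbit:
  assumes A: "finite A" "w permutes A" and x: "x \<in> A" and y: "y \<in> A - orbit w x"
  defines "Q \<equiv> orbit w x \<union> orbit w y"
  shows "card {v \<in> sqrts A w. v x = y}
    = (if card (orbit w y) = card (orbit w x) then card (sqrts (A - Q) (perm_restrict w (A - Q))) else 0)"
proof -
  have w: "permutation w" using permutes_finite_permutation A by auto
  have self: "z \<in> orbit w z" for z by (rule permutation_self_in_orbit[OF w])
  have orb: "orbit w x = range (\<lambda>i. (w ^^ i) x)"
    using orbit_altdef_permutation[OF w, of x] by auto
  have vorb: "v ` orbit w x = orbit w y" if "v \<in> sqrts A w" "v x = y" for v
    using orbit_inverse[OF self, of x w v] that sqrts_funpow[OF that(1), of 1] by simp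
  show ?thesis
  proof (cases "card (orbit w y) = card (orbit w x)")
    case False
    have "{v \<in> sqrts A w. v x = y} = {}"
    proof safe
      fix v assume v: "v \<in> sqrts A w" "y = v x"
      then have "inj v" using permutes_inj by (auto simp: sqrts_def)
      then have "card (v ` orbit w x) = card (orbit w x)" by (intro card_image) (auto simp: inj_on_def dest: injD)
      then show "v \<in> {}" using False vorb[OF v(1)] v(2) by simp
    qed
    then show ?thesis using False by (simp only: card.empty if_False)
  next
    case True
    obtain h where h: "bij_betw h (orbit w x) (orbit w y)" "h x = y"
      "\<And>z. z \<in> orbit w x \<Longrightarrow> h (w z) = w (h z)"
      using orbit_equivariant_bij[OF w w, of x y] True by auto
    have disj: "orbit w x \<inter> orbit w y = {}"
      using y orbit_eq_iff_mem[OF w] self by blast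
    \<comment> \<open>On the first cycle this is \<open>h\<close>, on the second \<open>w\<close>
      after the inverse of \<open>h\<close>, as \<open>u (u z) = w z\<close> demands.\<close>
    define u where "u = (\<lambda>z. if z \<in> orbit w x then h z
      else if z \<in> orbit w y then w (inv_into (orbit w x) h z) else z)"
    have ux: "u z = h z" "h z \<in> orbit w y" if "z \<in> orbit w x" for z
      using that bij_betw_apply[OF h(1)] by (auto simp: u_def)
    have uy: "u (h t) = w t" if "t \<in> orbit w x" for t
    proof -
      have "h t \<notin> orbit w x" using ux(2)[OF that] disj by auto
      then show ?thesis
        using ux(2)[OF that] inv_into_f_f[OF bij_betw_imp_inj_on[OF h(1)] that] by (simp add: u_def)
    qed
    have y_cases: "\<exists>t\<in>orbit w x. z = h t" if "z \<in> orbit w y" for z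
      using h(1) that by (auto simp: bij_betw_def)
    have uu: "u (u z) = w z" if "z \<in> Q" for z
    proof (cases "z \<in> orbit w x")
      case True
      then show ?thesis using ux uy by simp
    next
      case False
      then obtain t where "t \<in> orbit w x" "z = h t" using y_cases \<open>z \<in> Q\<close> by (auto simp: Q_def)
      then show ?thesis using uy ux h(3) orbit_step_mem_iff[OF w] by simp
    qed
    have QA: "Q \<subseteq> A" unfolding Q_def using permutes_orbit_subset[OF A(2)] x y by auto
    have u: "u permutes Q"
    proof (rule inj_imp_permutes)
      show "finite Q" using QA A finite_subset by blast
      show "inj_on u Q"
        by (rule inj_onI) (metis uu permutes_inj[OF A(2)] injD)
      fix z assume "z \<in> Q"
      then consider "z \<in> orbit w x" | t where "t \<in> orbit w x" "z = h t"
        using y_cases by (auto simp: Q_def)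
      then show "u z \<in> Q"
        by cases (simp_all add: ux uy orbit_step_mem_iff[OF w] Q_def)
    qed (auto simp: u_def Q_def)
    have "{v \<in> sqrts A w. v x = y} = {v \<in> sqrts A w. \<forall>z\<in>Q. v z = u z}"
    proof (intro Collect_cong conj_cong refl iffI)
      fix v assume v: "v \<in> sqrts A w" "v x = y"
      have vx: "v z = h z" if z: "z \<in> orbit w x" for z
      proof -
        obtain i where i: "z = (w ^^ i) x" using z by (auto simp: orb)
        have "h ((w ^^ i) x) = (w ^^ i) y" for i
          by (induction i) (auto simp: h(2,3) orb)
        then show ?thesis using sqrts_funpow[OF v(1), of i x] v(2) by (simp add: i)
      qed
      have vy: "v (h t) = w t" if "t \<in> orbit w x" for t
        using vx[OF that] v(1) by (auto simp: sqrts_def)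
      show "\<forall>z\<in>Q. v z = u z"
      proof
        fix z assume "z \<in> Q"
        then consider "z \<in> orbit w x" | t where "t \<in> orbit w x" "z = h t"
          using y_cases by (auto simp: Q_def)
        then show "v z = u z" by cases (simp_all add: vx ux vy uy)
      qed
    next
      fix v assume "\<forall>z\<in>Q. v z = u z"
      then show "v x = y" using self[of x] ux(1)[of x] h(2) by (auto simp: Q_def)
    qed
    then show ?thesis using card_sqrts_extending[OF A QA u uu] True by simp
  qed
qed

text \<open>Serves to count the candidates for the image of a point that is moved to another cycle
  of the same length.\<close>

lemma card_orbits_same_size:
  assumes A: "finite A" "w permutes A"
  shows "card {y \<in> A. card (orbit w y) = k} = k * count (orbits_type A w) k"
proof -
  have w: "permutation w" using permutes_finite_permutation A by auto
  let ?X = "{Q \<in> orbit w ` A. card Q = k}"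
  have "{y \<in> A. card (orbit w y) = k} = \<Union>?X"
  proof
    show "{y \<in> A. card (orbit w y) = k} \<subseteq> \<Union>?X"
      using permutation_self_in_orbit[OF w] by blast
    show "\<Union>?X \<subseteq> {y \<in> A. card (orbit w y) = k}"
    proof
      fix y assume "y \<in> \<Union>?X"
      then obtain x where "x \<in> A" "card (orbit w x) = k" "y \<in> orbit w x" by auto
      moreover from this have "orbit w y = orbit w x" using orbit_eq_iff_mem[OF w] by blast
      ultimately show "y \<in> {y \<in> A. card (orbit w y) = k}"
        using permutes_orbit_subset[OF A(2)] by auto
    qed
  qed
  moreover have "card (\<Union>?X) = (\<Sum>Q\<in>?X. card Q)"
  proof (rule card_Union_disjoint)
    show "pairwise disjnt ?X"
      using orbit_eq_iff_mem[OF w] by (auto simp: pairwise_def disjnt_def) blast+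
    show "finite Q" if "Q \<in> ?X" for Q
      using that finite_subset[OF permutes_orbit_subset[OF A(2)] A(1)] by auto
  qed
  moreover have "count (orbits_type A w) k = card ?X"
    using A(1) by (auto simp: orbits_type_def count_image_mset' intro!: arg_cong[where f = card])
  ultimately show ?thesis by simp
qed

text \<open>Strong induction on the size of the set: roots are sorted by the image \<open>y\<close>
  of a chosen \<open>x\<close>, and the cycles of \<open>x\<close> and \<open>y\<close> are removed,
  which reproduces \<open>c_factor_rec\<close> for the length of the cycle of \<open>x\<close>. The
  bound \<open>N\<close> stays fixed, so all products run over the same lengths.\<close>

lemma card_sqrts:
  assumes "finite A" "w permutes A" "card A \<le> N"
  shows "card (sqrts A w) = (\<Prod>i=1..N. c_factor i (count (orbits_type A w) i))"
  using assms
proof (induction "card A" arbitrary: A w rule: less_induct)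
  case less
  note A = less.prems(1,2)
  show ?case
  proof (cases "A = {}")
    case True
    then have "sqrts A w = {id}" using A by (auto simp: sqrts_def)
    then show ?thesis using True by (simp add: orbits_type_def)
  next
    case False
    then obtain x where x: "x \<in> A" by auto
    have w: "permutation w" using permutes_finite_permutation A by auto
    have self: "z \<in> orbit w z" for z by (rule permutation_self_in_orbit[OF w])
    let ?O = "orbit w x"
    let ?k = "card ?O"
    have OA: "orbit w z \<subseteq> A" if "z \<in> A" for z using permutes_orbit_subset[OF A(2) that] .
    have k: "?k \<in> {1..N}"
      using OA[OF x] self[of x] A(1) less.prems(3) card_mono[of A ?O]
      by (auto simp: Suc_le_eq card_gt_0_iff finite_subset)
    let ?M = "\<lambda>Q. orbits_type (A - Q) (perm_restrict w (A - Q))"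
    let ?P = "\<lambda>M. \<Prod>i=1..N. c_factor i (count M i)"
    \<comment> \<open>The factors for the other lengths, unchanged when cycles of length
      \<open>?k\<close> are removed.\<close>
    let ?R = "\<Prod>i\<in>{1..N} - {?k}. c_factor i (count (orbits_type A w) i)"
    let ?m = "count (?M ?O) ?k"
    have IH: "card (sqrts (A - Q) (perm_restrict w (A - Q))) = ?P (?M Q)"
      if "x \<in> Q" "\<And>z. w z \<in> Q \<longleftrightarrow> z \<in> Q" for Q
    proof (rule less.hyps)
      show "card (A - Q) < card A" using A x that by (intro psubset_card_mono) auto
      then show "card (A - Q) \<le> N" using less.prems(3) by simp
      show "perm_restrict w (A - Q) permutes (A - Q)"
        by (rule perm_restrict_permutes[OF A that(2)])
    qed (use A in simp)
    have M1: "orbits_type A w = add_mset ?k (?M ?O)"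
      using orbits_type_remove[OF A x, of "{}"] A(2) by simp
    have split: "?P M = c_factor ?k (count M ?k) * ?R"
      if "\<And>i. i \<noteq> ?k \<Longrightarrow> count M i = count (orbits_type A w) i" for M
      using that k by (subst prod.remove[of _ ?k]) (auto intro!: prod.cong)
    have same: "(\<Sum>y\<in>?O. card {v \<in> sqrts A w. v x = y}) = (if odd ?k then c_factor ?k ?m else 0) * ?R"
      using card_sqrts_same_orbit[OF A x] IH[of ?O] orbit_step_mem_iff[OF w] self split[of "?M ?O"] M1
      by simp
    \<comment> \<open>Removing a second cycle of length \<open>?k\<close> lowers the remaining count
      from \<open>?m\<close> to \<open>?m - 1\<close>.\<close>
    have other: "card {v \<in> sqrts A w. v x = y}
        = (if card (orbit w y) = ?k then c_factor ?k (?m - 1) * ?R else 0)" if y: "y \<in> A - ?O" for y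
    proof (cases "card (orbit w y) = ?k")
      case True
      have "?M ?O = add_mset ?k (?M (?O \<union> orbit w y))"
        using orbits_type_remove[OF A, of y ?O] y orbit_step_mem_iff[OF w] True by simp
      then show ?thesis
        using card_sqrts_other_orbit[OF A x y] IH[of "?O \<union> orbit w y"] orbit_step_mem_iff[OF w] self
          split[of "?M (?O \<union> orbit w y)"] M1 True by simp
    next
      case False
      then show ?thesis using card_sqrts_other_orbit[OF A x y] by simp
    qed
    \<comment> \<open>\<open>?m\<close> is the number of cycles of length \<open>?k\<close> other
      than that of \<open>x\<close>; each contributes \<open>?k\<close> points.\<close>
    have num: "card {y \<in> A - ?O. card (orbit w y) = ?k} = ?k * ?m"
    proof -
      have "orbit w y = ?O" if "y \<in> ?O" for y using that orbit_eq_iff_mem[OF w] by blast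
      then have "{y \<in> A. card (orbit w y) = ?k} = ?O \<union> {y \<in> A - ?O. card (orbit w y) = ?k}"
        using OA[OF x] by auto
      moreover have "card (?O \<union> {y \<in> A - ?O. card (orbit w y) = ?k})
          = ?k + card {y \<in> A - ?O. card (orbit w y) = ?k}"
        using A(1) finite_subset[OF OA[OF x] A(1)] by (intro card_Un_disjoint) auto
      ultimately have "?k * Suc ?m = ?k + card {y \<in> A - ?O. card (orbit w y) = ?k}"
        using card_orbits_same_size[OF A, of ?k] by (simp add: M1)
      then show ?thesis by simp
    qed
    have "sqrts A w = (\<Union>y\<in>A. {v \<in> sqrts A w. v x = y})"
      using x permutes_in_image by (fastforce simp: sqrts_def)
    then have "card (sqrts A w) = card (\<Union>y\<in>A. {v \<in> sqrts A w. v x = y})" by simp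
    also have "\<dots> = (\<Sum>y\<in>A. card {v \<in> sqrts A w. v x = y})"
      by (rule card_UN_disjoint) (use A(1) finite_sqrts[OF A(1)] in auto)
    also have "\<dots> = (\<Sum>y\<in>A - ?O. card {v \<in> sqrts A w. v x = y}) + (\<Sum>y\<in>?O. card {v \<in> sqrts A w. v x = y})"
      by (rule sum.subset_diff[OF OA[OF x] A(1)])
    also have "(\<Sum>y\<in>A - ?O. card {v \<in> sqrts A w. v x = y})
        = (\<Sum>y\<in>A - ?O. if card (orbit w y) = ?k then c_factor ?k (?m - 1) * ?R else 0)"
      by (rule sum.cong[OF refl other])
    also have "\<dots> = (\<Sum>y\<in>{y \<in> A - ?O. card (orbit w y) = ?k}. c_factor ?k (?m - 1) * ?R)"
      using A(1) by (intro sum.inter_filter[symmetric]) simp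
    also have "\<dots> = ?k * ?m * c_factor ?k (?m - 1) * ?R" by (simp only: sum_constant num of_nat_id mult.assoc)
    finally have "card (sqrts A w) = c_factor ?k (Suc ?m) * ?R"
      unfolding same c_factor_rec[of ?k ?m] by (simp add: algebra_simps)
    then show ?thesis using split[of "orbits_type A w"] by (simp add: M1)
  qed
qed

section \<open>Expansion of class functions\<close>

definition class_fun :: "nat \<Rightarrow> ((nat \<Rightarrow> nat) \<Rightarrow> complex) \<Rightarrow> bool" where
  "class_fun n F \<longleftrightarrow> F \<in> group_algebra n \<and>
     (\<forall>w\<in>sym_grp n. \<forall>h\<in>sym_grp n. F (inv h \<circ> w \<circ> h) = F w)"

definition cycle_types :: "nat \<Rightarrow> nat multiset set" where
  "cycle_types n = cycle_type n ` sym_grp n"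

definition type_indicator :: "nat \<Rightarrow> nat multiset \<Rightarrow> (nat \<Rightarrow> nat) \<Rightarrow> complex" where
  "type_indicator n M = (\<lambda>w. if w \<in> sym_grp n \<and> cycle_type n w = M then 1 else 0)"

lemma class_fun_cycle_type:
  assumes F: "class_fun n F" and w: "w \<in> sym_grp n" "w' \<in> sym_grp n"
    and eq: "cycle_type n w = cycle_type n w'"
  shows "F w = F w'"
proof -
  obtain p where p: "p permutes {..<n}" "w' = p \<circ> w \<circ> inv p"
    using orbits_type_eq_imp_conj[of "{..<n}" w w'] w eq by (auto simp: sym_grp_def cycle_type_eq)
  then have pG: "p \<in> sym_grp n" by (simp add: sym_grp_def)
  have "F (inv (inv p) \<circ> w \<circ> inv p) = F w"
    using F w(1) sym_grp_inv[OF pG] unfolding class_fun_def by blast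
  then show ?thesis using p(2) pG by simp
qed

text \<open>Class functions are constant on cycle types, so values at representatives serve as
  coefficients. This bounds the dimension by the number of cycle types.\<close>

lemma class_fun_span:
  assumes F: "class_fun n F"
  shows "F \<in> cfun.span (type_indicator n ` cycle_types n)"
proof -
  define r where "r = (\<lambda>M. SOME w. w \<in> sym_grp n \<and> cycle_type n w = M)"
  have r: "r M \<in> sym_grp n" "cycle_type n (r M) = M" if "M \<in> cycle_types n" for M
    using that someI_ex[of "\<lambda>w. w \<in> sym_grp n \<and> cycle_type n w = M"]
    by (auto simp: cycle_types_def r_def)
  have fin: "finite (cycle_types n)" by (simp add: cycle_types_def)
  have "F = (\<Sum>M\<in>cycle_types n. cscale (F (r M)) (type_indicator n M))"
  proof (rule group_algebra_eqI)
    show "F \<in> group_algebra n" using F by (simp add: class_fun_def)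
    show "(\<Sum>M\<in>cycle_types n. cscale (F (r M)) (type_indicator n M)) \<in> group_algebra n"
      by (simp add: group_algebra_iff fun_sum_apply cscale_def type_indicator_def)
    fix w assume w: "w \<in> sym_grp n"
    have M: "cycle_type n w \<in> cycle_types n" using w by (simp add: cycle_types_def)
    have "(\<Sum>M\<in>cycle_types n. cscale (F (r M)) (type_indicator n M)) w
        = (\<Sum>M\<in>cycle_types n. if cycle_type n w = M then F (r M) else 0)"
      using w by (auto simp: fun_sum_apply cscale_def type_indicator_def intro!: sum.cong)
    also have "\<dots> = F (r (cycle_type n w))" using fin M by simp
    also have "\<dots> = F w" by (rule class_fun_cycle_type[OF F r(1)[OF M] w r(2)[OF M]])
    finally show "F w = (\<Sum>M\<in>cycle_types n. cscale (F (r M)) (type_indicator n M)) w" by simp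
  qed
  also have "\<dots> \<in> cfun.span (type_indicator n ` cycle_types n)"
    by (intro cfun.span_sum cfun.span_scale cfun.span_base imageI)
  finally show ?thesis .
qed

section \<open>Cycle types as partitions\<close>

lemma length_le_sum_list: "0 \<notin> set \<nu> \<Longrightarrow> length \<nu> \<le> sum_list (\<nu> :: nat list)"
  by (induction \<nu>) auto

lemma finite_partitions: "finite {\<nu>. is_partition n \<nu>}"
proof (rule finite_subset)
  show "{\<nu>. is_partition n \<nu>} \<subseteq> {\<nu>. set \<nu> \<subseteq> {..n} \<and> length \<nu> \<le> n}"
    using length_le_sum_list member_le_sum_list by (fastforce simp: is_partition_def)
qed (rule finite_lists_length_le, simp)

lemma sum_mset_orbits_type:
  assumes A: "finite A" "w permutes A"
  shows "\<Sum>\<^sub># (orbits_type A w) = card A"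
proof -
  have w: "permutation w" using permutes_finite_permutation A by auto
  have "card (\<Union>(orbit w ` A)) = (\<Sum>Q\<in>orbit w ` A. card Q)"
  proof (rule card_Union_disjoint)
    show "pairwise disjnt (orbit w ` A)"
      using orbit_eq_iff_mem[OF w] by (auto simp: pairwise_def disjnt_def) blast+
    show "finite Q" if "Q \<in> orbit w ` A" for Q
      using that finite_subset[OF permutes_orbit_subset[OF A(2)] A(1)] by auto
  qed
  moreover have "\<Union>(orbit w ` A) = A"
    using permutes_orbit_subset[OF A(2)] permutation_self_in_orbit[OF w] by blast
  ultimately show ?thesis by (simp add: orbits_type_def sum_unfold_sum_mset)
qed

lemma cycle_types_subset: "cycle_types n \<subseteq> mset ` {\<nu>. is_partition n \<nu>}"
proof
  fix M assume "M \<in> cycle_types n"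
  then obtain w where w: "w permutes {..<n}" "M = orbits_type {..<n} w"
    by (auto simp: cycle_types_def cycle_type_eq sym_grp_def)
  have w': "permutation w" using permutes_finite_permutation w by auto
  have card_pos: "0 < card (orbit w x)" for x
    using finite_orbit[OF permutation_self_in_orbit[OF w']] orbit_nonempty[of w x]
    by (simp add: card_gt_0_iff)
  have "0 \<notin># M" by (auto simp: w(2) orbits_type_def) (metis card_pos less_irrefl)
  moreover have "\<Sum>\<^sub># M = n" using sum_mset_orbits_type[OF _ w(1)] w(2) by simp
  moreover have "sorted_wrt (\<ge>) (rev (sorted_list_of_multiset M))"
    by (simp add: sorted_wrt_rev)
  ultimately have "is_partition n (rev (sorted_list_of_multiset M))"
    by (simp add: is_partition_def flip: sum_mset_sum_list)
  then show "M \<in> mset ` {\<nu>. is_partition n \<nu>}"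
    by (intro image_eqI[of _ _ "rev (sorted_list_of_multiset M)"]) simp_all
qed

section \<open>Irreducible characters as a basis of the class functions\<close>

definition irr_fun :: "nat \<Rightarrow> nat list \<Rightarrow> (nat \<Rightarrow> nat) \<Rightarrow> complex" where
  "irr_fun n \<nu> = (\<lambda>w. if w \<in> sym_grp n then irr_char n \<nu> w else 0)"

lemma class_fun_irr_fun: "is_partition n \<nu> \<Longrightarrow> class_fun n (irr_fun n \<nu>)"
  by (auto simp: class_fun_def group_algebra_iff irr_fun_def irr_char_class)

lemma irr_fun_orthonormal:
  assumes "is_partition n \<nu>" "is_partition n \<nu>'"
  shows "(\<Sum>w\<in>sym_grp n. irr_fun n \<nu> w * irr_fun n \<nu>' w) = (if \<nu> = \<nu>' then fact n else 0)"
  using irr_char_orthonormal[OF assms] by (simp add: irr_fun_def cong: sum.cong)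

lemma inj_on_irr_fun: "inj_on (irr_fun n) {\<nu>. is_partition n \<nu>}"
proof (rule inj_onI)
  fix \<nu> \<nu>' assume p: "\<nu> \<in> {\<nu>. is_partition n \<nu>}" "\<nu>' \<in> {\<nu>. is_partition n \<nu>}"
    and eq: "irr_fun n \<nu> = irr_fun n \<nu>'"
  show "\<nu> = \<nu>'"
    using irr_fun_orthonormal[of n \<nu> \<nu>'] irr_fun_orthonormal[of n \<nu> \<nu>] p eq
    by (auto split: if_splits)
qed

text \<open>Orthogonality extracts one coefficient. The sum is indexed by functions because
  independence and span refer to sets of functions; injectivity of \<open>irr_fun\<close> translates
  it to partitions.\<close>

lemma sum_irr_fun_combination:
  assumes "is_partition n \<nu>"
  shows "(\<Sum>w\<in>sym_grp n. (\<Sum>x\<in>irr_fun n ` {\<nu>. is_partition n \<nu>}. cscale (u x) x) w * irr_fun n \<nu> w)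
    = fact n * u (irr_fun n \<nu>)"
proof -
  let ?P = "{\<nu>. is_partition n \<nu>}"
  have "(\<Sum>w\<in>sym_grp n. (\<Sum>x\<in>irr_fun n ` ?P. cscale (u x) x) w * irr_fun n \<nu> w)
      = (\<Sum>w\<in>sym_grp n. \<Sum>\<nu>'\<in>?P. u (irr_fun n \<nu>') * (irr_fun n \<nu>' w * irr_fun n \<nu> w))"
    by (simp add: sum.reindex[OF inj_on_irr_fun] fun_sum_apply cscale_def sum_distrib_right mult.assoc)
  also have "\<dots> = (\<Sum>\<nu>'\<in>?P. u (irr_fun n \<nu>') * (\<Sum>w\<in>sym_grp n. irr_fun n \<nu>' w * irr_fun n \<nu> w))"
    by (subst sum.swap) (simp add: sum_distrib_left)
  also have "\<dots> = (\<Sum>\<nu>'\<in>?P. if \<nu>' = \<nu> then fact n * u (irr_fun n \<nu>) else 0)"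
    using assms by (intro sum.cong refl) (simp add: irr_fun_orthonormal)
  finally show ?thesis using assms finite_partitions[of n] by simp
qed

lemma independent_irr_fun: "cfun.independent (irr_fun n ` {\<nu>. is_partition n \<nu>})"
proof (rule cfun.independent_if_scalars_zero)
  show "finite (irr_fun n ` {\<nu>. is_partition n \<nu>})" using finite_partitions by simp
  fix u x
  assume 0: "(\<Sum>x\<in>irr_fun n ` {\<nu>. is_partition n \<nu>}. cscale (u x) x) = 0"
    and x: "x \<in> irr_fun n ` {\<nu>. is_partition n \<nu>}"
  then obtain \<nu> where \<nu>: "is_partition n \<nu>" "x = irr_fun n \<nu>" by auto
  show "u x = 0" using sum_irr_fun_combination[OF \<nu>(1), of u] \<nu>(2) unfolding 0 by simp
qed

lemma card_irr_fun: "card (irr_fun n ` {\<nu>. is_partition n \<nu>}) = card {\<nu>. is_partition n \<nu>}"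
  by (rule card_image[OF inj_on_irr_fun])

lemma finite_cycle_types [simp]: "finite (cycle_types n)"
  by (simp add: cycle_types_def)

text \<open>Independence of the irreducible characters bounds the number of partitions by the number of
  cycle types. As cycle types are partitions, both numbers agree: every partition is a cycle type,
  without constructing a permutation, and the irreducible characters span the class functions.\<close>

lemma card_class_fun_independent:
  assumes "cfun.independent S" "\<And>F. F \<in> S \<Longrightarrow> class_fun n F"
  shows "card S \<le> card (cycle_types n)"
proof -
  have "card S \<le> card (type_indicator n ` cycle_types n)"
    using cfun.independent_span_bound[of "type_indicator n ` cycle_types n" S] assms class_fun_span
    by auto
  also have "\<dots> \<le> card (cycle_types n)" by (rule card_image_le) simp
  finally show ?thesis .
qed

lemma cycle_types_eq: "cycle_types n = mset ` {\<nu>. is_partition n \<nu>}"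
proof (rule card_subset_eq[OF _ cycle_types_subset])
  show "finite (mset ` {\<nu>. is_partition n \<nu>})" using finite_partitions by simp
  have "card (mset ` {\<nu>. is_partition n \<nu>}) \<le> card {\<nu>. is_partition n \<nu>}"
    by (rule card_image_le[OF finite_partitions])
  also have "\<dots> \<le> card (cycle_types n)"
    using card_class_fun_independent[OF independent_irr_fun, of n] class_fun_irr_fun
    by (auto simp: card_irr_fun)
  finally show "card (cycle_types n) = card (mset ` {\<nu>. is_partition n \<nu>})"
    using card_mono[OF _ cycle_types_subset] finite_partitions by (metis le_antisym finite_imageI)
qed

text \<open>A class function outside the span of the characters would enlarge an independent family
  beyond the number of cycle types. Pairing with the characters then identifies the
  coefficients.\<close>

lemma class_fun_expansion:
  assumes F: "class_fun n F" and w: "w \<in> sym_grp n"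
  shows "F w = (\<Sum>\<nu> | is_partition n \<nu>.
    (\<Sum>v\<in>sym_grp n. F v * irr_char n \<nu> v) / fact n * irr_char n \<nu> w)"
proof -
  let ?P = "{\<nu>. is_partition n \<nu>}"
  let ?S = "irr_fun n ` ?P"
  have finS: "finite ?S" using finite_partitions by simp
  have "F \<in> cfun.span ?S"
  proof (rule ccontr)
    assume F': "F \<notin> cfun.span ?S"
    then have "cfun.independent (insert F ?S)"
      using independent_irr_fun by (rule cfun.independent_insertI)
    then have "card (insert F ?S) \<le> card (cycle_types n)"
      by (rule card_class_fun_independent) (use F class_fun_irr_fun in auto)
    moreover have "F \<notin> ?S" using F' cfun.span_base[of F ?S] by blast
    ultimately have "card ?P < card (cycle_types n)" using finS by (simp add: card_irr_fun)
    also have "\<dots> \<le> card ?P" unfolding cycle_types_eq by (rule card_image_le[OF finite_partitions])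
    finally show False by simp
  qed
  then obtain u where u: "F = (\<Sum>x\<in>?S. cscale (u x) x)"
    unfolding cfun.span_finite[OF finS] by auto
  have coeff: "(\<Sum>v\<in>sym_grp n. F v * irr_char n \<nu> v) / fact n = u (irr_fun n \<nu>)" if "\<nu> \<in> ?P" for \<nu>
  proof -
    have "(\<Sum>v\<in>sym_grp n. F v * irr_char n \<nu> v) = (\<Sum>v\<in>sym_grp n. F v * irr_fun n \<nu> v)"
      by (simp add: irr_fun_def)
    also have "\<dots> = fact n * u (irr_fun n \<nu>)"
      unfolding u using that by (intro sum_irr_fun_combination) simp
    finally show ?thesis by simp
  qed
  have "irr_fun n \<nu> w = irr_char n \<nu> w" for \<nu> using w by (simp add: irr_fun_def)
  then have "F w = (\<Sum>\<nu>\<in>?P. u (irr_fun n \<nu>) * irr_char n \<nu> w)"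
    unfolding u by (simp add: sum.reindex[OF inj_on_irr_fun] fun_sum_apply cscale_def)
  also have "\<dots> = (\<Sum>\<nu>\<in>?P. (\<Sum>v\<in>sym_grp n. F v * irr_char n \<nu> v) / fact n * irr_char n \<nu> w)"
    by (intro sum.cong refl) (simp only: coeff)
  finally show ?thesis .
qed

text \<open>Pairing the square root count with a character sums the character over all squares, so
  by \<open>irr_char_indicator\<close> every coefficient in the expansion of this class function is
  1.\<close>

lemma sum_irr_char_eq_card_sqrts:
  assumes w: "w \<in> sym_grp n"
  shows "(\<Sum>\<nu> | is_partition n \<nu>. irr_char n \<nu> w) = of_nat (card (sqrts {..<n} w))"
proof -
  define r :: "(nat \<Rightarrow> nat) \<Rightarrow> complex"
    where "r = (\<lambda>w. if w \<in> sym_grp n then of_nat (card (sqrts {..<n} w)) else 0)"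
  have r_sum: "r w = (\<Sum>v\<in>sym_grp n. if v \<circ> v = w then 1 else 0)" if "w \<in> sym_grp n" for w
  proof -
    have "sqrts {..<n} w = {v \<in> sym_grp n. v \<circ> v = w}" by (auto simp: sqrts_def sym_grp_def)
    then have "r w = (\<Sum>v\<in>{v \<in> sym_grp n. v \<circ> v = w}. 1)" using that by (simp add: r_def)
    also have "\<dots> = (\<Sum>v\<in>sym_grp n. if v \<circ> v = w then 1 else 0)" by (rule sum.inter_filter) simp
    finally show ?thesis .
  qed
  have "class_fun n r"
    unfolding class_fun_def
  proof (intro conjI ballI)
    show "r \<in> group_algebra n" by (simp add: group_algebra_iff r_def)
    fix w h assume wh: "w \<in> sym_grp n" "h \<in> sym_grp n"
    \<comment> \<open>By \<open>card_sqrts\<close> the count depends on the cycle type only, and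
      conjugation preserves that.\<close>
    have "orbits_type {..<n} (inv h \<circ> w \<circ> h) = orbits_type {..<n} w"
      using orbits_type_conj[of "{..<n}" w "inv h"] wh sym_grp_inv[OF wh(2)]
      by (simp add: sym_grp_def[of n] permutes_inv_inv)
    moreover have "inv h \<circ> w \<circ> h \<in> sym_grp n" using wh by simp
    ultimately show "r (inv h \<circ> w \<circ> h) = r w"
      using wh card_sqrts[of "{..<n}" "inv h \<circ> w \<circ> h" n] card_sqrts[of "{..<n}" w n]
      unfolding r_def sym_grp_def by simp
  qed
  from class_fun_expansion[OF this w]
  have "r w = (\<Sum>\<nu> | is_partition n \<nu>.
    (\<Sum>w\<in>sym_grp n. r w * irr_char n \<nu> w) / fact n * irr_char n \<nu> w)" .
  also have "\<dots> = (\<Sum>\<nu> | is_partition n \<nu>. irr_char n \<nu> w)"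
  proof (rule sum.cong[OF refl])
    fix \<nu> assume "\<nu> \<in> {\<nu>. is_partition n \<nu>}"
    then have \<nu>: "is_partition n \<nu>" by simp
    have "(\<Sum>w\<in>sym_grp n. r w * irr_char n \<nu> w)
        = (\<Sum>w\<in>sym_grp n. \<Sum>v\<in>sym_grp n. if v \<circ> v = w then irr_char n \<nu> w else 0)"
      by (intro sum.cong refl) (auto simp: r_sum sum_distrib_right intro!: sum.cong)
    also have "\<dots> = (\<Sum>v\<in>sym_grp n. \<Sum>w\<in>sym_grp n. if v \<circ> v = w then irr_char n \<nu> w else 0)"
      by (rule sum.swap)
    also have "\<dots> = (\<Sum>v\<in>sym_grp n. irr_char n \<nu> (v \<circ> v))"
      by (intro sum.cong refl) simp
    finally show "(\<Sum>w\<in>sym_grp n. r w * irr_char n \<nu> w) / fact n * irr_char n \<nu> w = irr_char n \<nu> w"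
      by (simp add: irr_char_indicator[OF \<nu>])
  qed
  finally show ?thesis using w by (simp add: r_def)
qed

theorem theorem22:
  fixes n :: nat and \<mu> :: "nat list"
  assumes "is_partition n \<mu>"
  shows "column_sum n \<mu> = of_nat (\<Prod>i=1..n. c_factor i (count_list \<mu> i))"
proof -
  \<comment> \<open>The representative chosen in \<open>char_value\<close>. Every partition is a
    cycle type by \<open>cycle_types_eq\<close>, so the choice has the intended property.\<close>
  define w where "w = (SOME w. w permutes {..<n} \<and> cycle_type n w = mset \<mu>)"
  have "mset \<mu> \<in> cycle_types n" using assms by (simp add: cycle_types_eq)
  then have "\<exists>w. w permutes {..<n} \<and> cycle_type n w = mset \<mu>"
    by (auto simp: cycle_types_def sym_grp_def)
  then have w: "w permutes {..<n}" "cycle_type n w = mset \<mu>"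
    unfolding w_def by (rule someI2_ex, simp)+
  have "column_sum n \<mu> = (\<Sum>\<nu> | is_partition n \<nu>. irr_char n \<nu> w)"
    by (simp add: column_sum_def char_value_def w_def)
  also have "\<dots> = of_nat (card (sqrts {..<n} w))"
    by (rule sum_irr_char_eq_card_sqrts) (simp add: sym_grp_def w)
  also have "card (sqrts {..<n} w) = (\<Prod>i=1..n. c_factor i (count_list \<mu> i))"
    using card_sqrts[OF _ w(1), of n] w(2) by (simp add: cycle_type_eq count_mset)
  finally show ?thesis .
qed

end
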